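(* There exist two continuous functions $f,g:\mathbb{T}\to\mathbb{T}$ such that $|\widehat{f}(n)|=|\widehat{g}(n)|$ for all $n\in\mathbb{Z}$ and such that $f$ and $g$ have different winding numbers.
   Context: $\mathbb{T}=\{z\in\mathbb{C}:|z|=1\}$. A function on $\mathbb{T}$ is identified with a $1$-periodic function of a real variable $t$ (equivalently a function on $[0,1]$ with $f(0)=f(1)$ when continuous), and $\widehat{f}(n)=\int_0^1 f(t)e^{-2\pi i n t}\,dt$ for $n\in\mathbb{Z}$. The winding number of a continuous closed curve $f$ in $\mathbb{C}\setminus\{0\}$ is its usual integer winding number around $0$ (the topological degree of $f/|f|:\mathbb{T}\to\mathbb{T}$). *)

theory Defs
  imports "HOL-Complex_Analysis.Complex_Analysis"
begin

text \<open>
  The circle is the set \<^term>\<open>sphere 0 1 :: complex set\<close>. A function \<open>f\<close> on the circle is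
  identified with the 1-periodic function \<open>t \<mapsto> f (exp (2 * pi * \<i> * t))\<close> of a real variable;
  \<^term>\<open>circlepath 0 1\<close> is the parametrization \<open>t \<mapsto> exp (2 * pi * \<i> * t)\<close>.
\<close>

definition circle_lift :: "(complex \<Rightarrow> complex) \<Rightarrow> real \<Rightarrow> complex" where
  "circle_lift f = f \<circ> circlepath 0 1"

definition fourier_coeff :: "(complex \<Rightarrow> complex) \<Rightarrow> int \<Rightarrow> complex" where
  "fourier_coeff f n =
     integral {0..1} (\<lambda>t::real. circle_lift f t * exp (- (2 * of_real pi * \<i> * of_int n * of_real t)))"

end

theory Submission
  imports Defs
begin

text \<open>
  It suffices to find one continuous \<open>f\<close> from the circle to itself, of winding number 1, whose Fourier
  coefficients at \<open>n\<close> and \<open>-n\<close> have equal modulus for all \<open>n\<close>: the conjugate of \<open>f\<close> has at \<open>n\<close> the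
  conjugate of the coefficient of \<open>f\<close> at \<open>-n\<close>, and it has winding number -1. If \<open>f\<close> were smooth, its
  winding number would be the sum of \<open>n\<close> times the squared modulus of the coefficient at \<open>n\<close>, and the
  symmetry would make it vanish; so \<open>f\<close> has to be rough, and it is obtained as the uniform limit of
  trigonometric polynomials with symmetric coefficients (\<open>balanced\<close>) whose modulus tends to 1.

  The construction rests on a simple observation: a constant times a real trigonometric polynomial is
  balanced, and a sum of balanced functions with disjoint spectra is balanced
  (\<open>balanced_add_real\<close>). Hence one may add to a balanced \<open>F\<close> any number of terms \<open>v Q\<close>, with \<open>v\<close>
  constant and \<open>Q\<close> real, if their frequencies are high and well separated. Where \<open>F\<close> is close to \<open>v\<close>,
  adding \<open>v (i a - (a\<^sup>2 - q) / 2)\<close>, with \<open>a\<close> real of high frequency and \<open>q\<close> the local mean of \<open>a\<^sup>2\<close>,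
  moves the value along a circle up to second order and raises the squared modulus from \<open>|F|\<^sup>2\<close> to about
  \<open>|F|\<^sup>2 (1 + q)\<close>, for an arbitrary small positive function \<open>q\<close>. The constants \<open>v\<close> are the nodes of a
  fine grid in the plane and \<open>a\<close> is distributed among them by a partition of unity in the variable
  \<open>F z\<close>; different nodes use very different frequencies (\<open>modulate\<close>, \<open>raise_modulus\<close>).

  Choosing \<open>q\<close> proportional to the defect \<open>1 - |F|\<^sup>2\<close> shrinks the defect by a fixed factor at the cost
  of moving \<open>F\<close> by a multiple of the square root of the defect (\<open>contraction_step\<close>). The displacements
  form a geometric series, and each of them is smaller than \<open>|F|\<close>, so the limit exists uniformly, is
  unimodular, and is homotopic to the initial function in the punctured plane (\<open>unimodular_limit\<close>).
  The initial function is a balanced trigonometric polynomial of degree 2 with winding number 1: a figure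
  eight with the origin inside one lobe.
\<close>

section \<open>Trigonometric polynomials with prescribed spectrum\<close>

text \<open>
  The set \<open>A\<close> is only required to contain the spectrum. This suffices for tracking disjointness and
  avoids any discussion of the uniqueness of the coefficients.
\<close>

definition trig_poly_on :: "int set \<Rightarrow> (complex \<Rightarrow> complex) \<Rightarrow> bool" where
  "trig_poly_on A F \<longleftrightarrow>
     finite A \<and> (\<exists>c. \<forall>z\<in>sphere 0 1. F z = (\<Sum>n\<in>A. c n * z powi n))"

lemma trig_poly_on_finite: "trig_poly_on A F \<Longrightarrow> finite A"
  by (simp add: trig_poly_on_def)

lemma trig_poly_on_cong:
  "trig_poly_on A F \<Longrightarrow> (\<And>z. z \<in> sphere 0 1 \<Longrightarrow> G z = F z) \<Longrightarrow> trig_poly_on A G"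
  by (simp add: trig_poly_on_def)

lemma trig_poly_on_mono:
  assumes "trig_poly_on A F" "A \<subseteq> B" "finite B"
  shows "trig_poly_on B F"
proof -
  from assms(1) obtain c where c: "\<forall>z\<in>sphere 0 1. F z = (\<Sum>n\<in>A. c n * z powi n)"
    by (auto simp: trig_poly_on_def)
  have "(\<Sum>n\<in>A. c n * z powi n) = (\<Sum>n\<in>B. (if n \<in> A then c n else 0) * z powi n)" for z
    using assms by (intro sum.mono_neutral_cong_left) auto
  with c assms show ?thesis by (auto simp: trig_poly_on_def intro!: exI[of _ "\<lambda>n. if n \<in> A then c n else 0"])
qed

lemma trig_poly_on_add:
  assumes "trig_poly_on A F" "trig_poly_on A G"
  shows "trig_poly_on A (\<lambda>z. F z + G z)"
proof -
  from assms obtain c d where "\<forall>z\<in>sphere 0 1. F z = (\<Sum>n\<in>A. c n * z powi n)"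
    "\<forall>z\<in>sphere 0 1. G z = (\<Sum>n\<in>A. d n * z powi n)"
    by (auto simp: trig_poly_on_def)
  then show ?thesis using assms
    by (auto simp: trig_poly_on_def sum.distrib[symmetric] distrib_right intro!: exI[of _ "\<lambda>n. c n + d n"])
qed

lemma trig_poly_on_cmult:
  assumes "trig_poly_on A F"
  shows "trig_poly_on A (\<lambda>z. w * F z)"
proof -
  from assms obtain c where "\<forall>z\<in>sphere 0 1. F z = (\<Sum>n\<in>A. c n * z powi n)"
    by (auto simp: trig_poly_on_def)
  then show ?thesis using assms
    by (auto simp: trig_poly_on_def sum_distrib_left mult.assoc intro!: exI[of _ "\<lambda>n. w * c n"])
qed

lemma trig_poly_on_sum:
  assumes "finite I" "finite A" "\<And>i. i \<in> I \<Longrightarrow> trig_poly_on A (F i)"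
  shows "trig_poly_on A (\<lambda>z. \<Sum>i\<in>I. F i z)"
  using assms(1,3)
proof (induction I rule: finite_induct)
  case empty
  show ?case using assms(2) by (auto simp: trig_poly_on_def intro!: exI[of _ "\<lambda>_. 0"])
next
  case (insert x I)
  then show ?case using trig_poly_on_add[of A "F x" "\<lambda>z. \<Sum>i\<in>I. F i z"] by simp
qed

lemma trig_poly_on_monom:
  assumes "finite A" "n \<in> A"
  shows "trig_poly_on A (\<lambda>z. w * z powi n)"
proof -
  have "(\<Sum>k\<in>A. (if k = n then w else 0) * z powi k) = w * z powi n" for z
    using assms by (subst sum.remove[of A n]) (auto intro!: sum.neutral)
  then show ?thesis using assms
    by (auto simp: trig_poly_on_def intro!: exI[of _ "\<lambda>k. if k = n then w else 0"])
qed

lemma trig_poly_on_mult: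
  assumes F: "trig_poly_on A F" and G: "trig_poly_on B G"
    and C: "finite C" "\<And>a b. a \<in> A \<Longrightarrow> b \<in> B \<Longrightarrow> a + b \<in> C"
  shows "trig_poly_on C (\<lambda>z. F z * G z)"
proof -
  from assms obtain c d where cd: "\<forall>z\<in>sphere 0 1. F z = (\<Sum>n\<in>A. c n * z powi n)"
    "\<forall>z\<in>sphere 0 1. G z = (\<Sum>n\<in>B. d n * z powi n)" and fin: "finite A" "finite B"
    by (auto simp: trig_poly_on_def)
  have "trig_poly_on C (\<lambda>z. \<Sum>a\<in>A. \<Sum>b\<in>B. (c a * d b) * z powi (a + b))"
    by (intro trig_poly_on_sum trig_poly_on_monom fin C)
  then show ?thesis
  proof (rule trig_poly_on_cong)
    fix z :: complex assume z: "z \<in> sphere 0 1"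
    then have "z \<noteq> 0" by auto
    then show "F z * G z = (\<Sum>a\<in>A. \<Sum>b\<in>B. (c a * d b) * z powi (a + b))"
      using cd z by (simp add: sum_product power_int_add mult_ac)
  qed
qed

lemma cnj_powi_sphere: "z \<in> sphere 0 1 \<Longrightarrow> cnj (z powi n) = z powi (-n)"
proof -
  assume "z \<in> sphere 0 1"
  then have z: "cmod z = 1" by auto
  then have "z \<noteq> 0" by auto
  have "cmod (z powi n) = 1" using z by (simp add: norm_power_int)
  then have "z powi n * cnj (z powi n) = 1"
    by (metis complex_norm_square of_real_1 one_power2)
  moreover have "z powi n * z powi (-n) = 1"
    using \<open>z \<noteq> 0\<close> by (simp add: power_int_minus)
  ultimately show ?thesis
    by (metis mult.left_neutral mult.assoc mult.commute)
qed

lemma trig_poly_on_Re_powi: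
  assumes "finite A" "n \<in> A" "-n \<in> A"
  shows "trig_poly_on A (\<lambda>z. of_real (Re (z powi n)))"
proof -
  have "trig_poly_on A (\<lambda>z. (1/2) * z powi n + (1/2) * z powi (-n))"
    using assms by (intro trig_poly_on_add trig_poly_on_monom)
  then show ?thesis
  proof (rule trig_poly_on_cong)
    fix z :: complex assume z: "z \<in> sphere 0 1"
    have "of_real (Re (z powi n)) = (z powi n + cnj (z powi n)) / 2"
      by (simp only: complex_add_cnj) simp
    then show "of_real (Re (z powi n)) = (1/2) * z powi n + (1/2) * z powi (-n)"
      by (simp only: cnj_powi_sphere[OF z]) (simp add: field_simps)
  qed
qed

text \<open>
  Averaging the given coefficients with those of the conjugate function makes them Hermitian, without
  an appeal to their uniqueness.
\<close>

lemma trig_poly_on_real_coeffs: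
  assumes "trig_poly_on A (\<lambda>z. of_real (Q z))" and sym: "\<And>n. n \<in> A \<Longrightarrow> -n \<in> A"
  obtains c where "\<And>n. c (-n) = cnj (c n)" "\<And>n. n \<notin> A \<Longrightarrow> c n = 0"
    "\<And>z. z \<in> sphere 0 1 \<Longrightarrow> of_real (Q z) = (\<Sum>n\<in>A. c n * z powi n)"
proof -
  from assms(1) obtain b where fin: "finite A"
    and b: "\<And>z. z \<in> sphere 0 1 \<Longrightarrow> of_real (Q z) = (\<Sum>n\<in>A. b n * z powi n)"
    by (auto simp: trig_poly_on_def)
  define c where "c n = (if n \<in> A then (b n + cnj (b (-n))) / 2 else 0)" for n
  show ?thesis
  proof
    show "c (-n) = cnj (c n)" for n
      using sym[of n] sym[of "-n"] by (auto simp: c_def add.commute)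
    show "n \<notin> A \<Longrightarrow> c n = 0" for n by (simp add: c_def)
    fix z :: complex assume z: "z \<in> sphere 0 1"
    have "cnj (of_real (Q z)) = (\<Sum>n\<in>A. cnj (b n) * z powi (-n))"
      unfolding b[OF z] cnj_sum complex_cnj_mult cnj_powi_sphere[OF z] ..
    also have "\<dots> = (\<Sum>n\<in>A. cnj (b (-n)) * z powi n)"
      by (rule sum.reindex_bij_witness[of _ uminus uminus]) (use sym in auto)
    finally have *: "of_real (Q z) = (\<Sum>n\<in>A. cnj (b (-n)) * z powi n)" by simp
    have "(\<Sum>n\<in>A. c n * z powi n) = (\<Sum>n\<in>A. (b n * z powi n + cnj (b (-n)) * z powi n) / 2)"
      by (intro sum.cong) (auto simp: c_def algebra_simps add_divide_distrib)
    also have "\<dots> = (of_real (Q z) + of_real (Q z)) / 2"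
      by (simp only: sum_divide_distrib[symmetric] sum.distrib b[OF z, symmetric] *[symmetric])
    finally show "of_real (Q z) = (\<Sum>n\<in>A. c n * z powi n)" by simp
  qed
qed

section \<open>Balanced functions\<close>

definition balanced :: "int set \<Rightarrow> (complex \<Rightarrow> complex) \<Rightarrow> bool" where
  "balanced A F \<longleftrightarrow> finite A \<and> (\<exists>c. (\<forall>n. cmod (c (-n)) = cmod (c n)) \<and> (\<forall>n. n \<notin> A \<longrightarrow> c n = 0) \<and>
     (\<forall>z\<in>sphere 0 1. F z = (\<Sum>n\<in>A. c n * z powi n)))"

lemma balanced_finite: "balanced A F \<Longrightarrow> finite A"
  by (simp add: balanced_def)

lemma balanced_continuous: "balanced A F \<Longrightarrow> continuous_on (sphere 0 1) F"
proof -
  assume "balanced A F"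
  then obtain c where c: "\<forall>z\<in>sphere 0 1. F z = (\<Sum>n\<in>A. c n * z powi n)"
    by (auto simp: balanced_def)
  have "continuous_on (sphere 0 1) (\<lambda>z::complex. \<Sum>n\<in>A. c n * z powi n)"
    by (intro continuous_intros) auto
  then show ?thesis using c by (metis (no_types, lifting) continuous_on_cong)
qed

text \<open>
  The coefficients of \<open>Q\<close> are Hermitian, and a constant factor does not affect the symmetry of their
  moduli. Since the spectra do not overlap, no coefficient of the sum mixes the two contributions.
\<close>

lemma balanced_add_real:
  assumes F: "balanced A F" and Q: "trig_poly_on B (\<lambda>z. of_real (Q z))"
    and sym: "\<And>n. n \<in> B \<Longrightarrow> -n \<in> B" and disj: "A \<inter> B = {}"
  shows "balanced (A \<union> B) (\<lambda>z. F z + w * of_real (Q z))"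
proof -
  from F obtain a where fin: "finite A" and a: "\<And>n. cmod (a (-n)) = cmod (a n)" "\<And>n. n \<notin> A \<Longrightarrow> a n = 0"
    "\<And>z. z \<in> sphere 0 1 \<Longrightarrow> F z = (\<Sum>n\<in>A. a n * z powi n)"
    unfolding balanced_def by blast
  obtain c where c: "\<And>n. c (-n) = cnj (c n)" "\<And>n. n \<notin> B \<Longrightarrow> c n = 0"
    "\<And>z. z \<in> sphere 0 1 \<Longrightarrow> of_real (Q z) = (\<Sum>n\<in>B. c n * z powi n)"
    using trig_poly_on_real_coeffs[OF Q sym] by metis
  have finB: "finite B" using Q trig_poly_on_finite by blast
  define e where "e n = (if n \<in> B then w * c n else a n)" for n
  have "cmod (e (-n)) = cmod (e n)" for n
    using sym[of n] sym[of "-n"] a(1)[of n] by (auto simp: e_def c(1) norm_mult)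
  moreover have "e n = 0" if "n \<notin> A \<union> B" for n
    using that by (simp add: e_def a(2))
  moreover have "F z + w * of_real (Q z) = (\<Sum>n\<in>A \<union> B. e n * z powi n)" if z: "z \<in> sphere 0 1" for z
  proof -
    have "(\<Sum>n\<in>A \<union> B. e n * z powi n) = (\<Sum>n\<in>A. e n * z powi n) + (\<Sum>n\<in>B. e n * z powi n)"
      using fin finB disj by (rule sum.union_disjoint)
    also have "(\<Sum>n\<in>A. e n * z powi n) = F z"
      unfolding a(3)[OF z] using disj by (intro sum.cong) (auto simp: e_def)
    also have "(\<Sum>n\<in>B. e n * z powi n) = w * of_real (Q z)"
      unfolding c(3)[OF z] sum_distrib_left by (intro sum.cong) (auto simp: e_def)
    finally show ?thesis by simp
  qed
  ultimately show ?thesis using fin finB unfolding balanced_def by blast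
qed

lemma finite_int_bound: "finite (A :: int set) \<Longrightarrow> \<exists>M\<ge>0. \<forall>n\<in>A. \<bar>n\<bar> \<le> M"
  by (rule exI[of _ "\<Sum>n\<in>A. \<bar>n\<bar>"]) (auto intro!: sum_nonneg member_le_sum)

lemma Re_powi_sphere_le: "z \<in> sphere 0 1 \<Longrightarrow> \<bar>Re (z powi n)\<bar> \<le> 1"
  using abs_Re_le_cmod[of "z powi n"] by (simp add: norm_power_int)

lemma Re_powi_double:
  assumes "z \<in> sphere 0 1"
  shows "(Re (z powi n))\<^sup>2 - 1/2 = Re (z powi (2 * n)) / 2"
proof -
  have "cmod (z powi n) = 1" using assms by (simp add: norm_power_int)
  then have "(Re (z powi n))\<^sup>2 + (Im (z powi n))\<^sup>2 = 1"
    by (metis cmod_power2 one_power2)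
  moreover have "z powi (2 * n) = (z powi n)\<^sup>2"
    by (metis mult.commute power_int_mult power_int_numeral)
  ultimately show ?thesis
    by (simp add: power2_eq_square field_simps)
qed

text \<open>
  The high-frequency perturbation. With \<open>\<alpha> = (\<Sum>j\<in>J. \<beta> j * C j)\<close> for carriers \<open>C j z = Re (z powi K j)\<close>, the
  perturbation \<open>P\<close> would equal \<open>w (\<i> \<alpha> - (\<alpha>\<^sup>2 - q) / 2)\<close> with \<open>q = (\<Sum>j\<in>J. (\<beta> j)\<^sup>2) / 2\<close> if all \<open>v j\<close> were equal
  to \<open>w\<close>; the estimate says that only the \<open>v j\<close> with \<open>\<beta> j z \<noteq> 0\<close> need to be close to \<open>w\<close>.

  Passing from \<open>J\<close> to \<open>insert j J\<close> increases \<open>\<i> \<alpha> - (\<alpha>\<^sup>2 - q) / 2\<close> by \<open>\<i> S + R\<close>, where \<open>S = \<beta> j C\<close> and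
  \<open>R = - (\<beta> j)\<^sup>2 (C\<^sup>2 - 1/2) / 2 - \<alpha> \<beta> j C\<close> are real. The complex combination \<open>\<i> S + R\<close> need not be symmetric,
  so the spectra of \<open>S\<close> and \<open>R\<close> must be disjoint. That of \<open>S\<close> lies within \<open>d\<close> of \<open>\<plusminus>K\<close>, that of the first
  part of \<open>R\<close> near \<open>\<plusminus>2K\<close>, and that of the cross term \<open>\<alpha> \<beta> j C\<close> stays away from \<open>\<plusminus>K\<close> by more than \<open>d\<close>
  because \<open>\<alpha>\<close> has no frequency in \<open>{-2d..2d}\<close>: this is why the induction carries that property.
\<close>

lemma modulate:
  fixes \<beta> :: "'j \<Rightarrow> complex \<Rightarrow> real" and v :: "'j \<Rightarrow> complex"
  assumes "finite J" and F: "balanced A0 F"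
    and \<beta>: "\<And>j. j \<in> J \<Longrightarrow> trig_poly_on {-d..d} (\<lambda>z. of_real (\<beta> j z))" and d: "0 \<le> d"
  shows "\<exists>A P E \<alpha>. balanced A (\<lambda>z. F z + P z) \<and>
           trig_poly_on E (\<lambda>z. of_real (\<alpha> z)) \<and> (\<forall>n\<in>E. -n \<in> E \<and> 2*d < \<bar>n\<bar>) \<and>
           (\<forall>z\<in>sphere 0 1. \<bar>\<alpha> z\<bar> \<le> (\<Sum>j\<in>J. \<bar>\<beta> j z\<bar>)) \<and>
           (\<forall>z\<in>sphere 0 1. \<forall>w.
              cmod (P z - w * (\<i> * of_real (\<alpha> z) - of_real (((\<alpha> z)\<^sup>2 - (\<Sum>j\<in>J. (\<beta> j z)\<^sup>2) / 2) / 2)))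
                \<le> (\<Sum>j\<in>J. cmod (v j - w) * \<bar>\<beta> j z\<bar>) * (1 + 2 * (\<Sum>j\<in>J. \<bar>\<beta> j z\<bar>)))"
  using assms(1) \<beta>
proof (induction J rule: finite_induct)
  case empty
  have "trig_poly_on {} (\<lambda>z. of_real 0)" by (simp add: trig_poly_on_def)
  then show ?case
    using F by (intro exI[of _ A0] exI[of _ "\<lambda>_. 0"] exI[of _ "{}"]) auto
next
  case (insert j J)
  then obtain A P E \<alpha> where bal: "balanced A (\<lambda>z. F z + P z)"
    and \<alpha>: "trig_poly_on E (\<lambda>z. of_real (\<alpha> z))"
    and E: "\<And>n. n \<in> E \<Longrightarrow> -n \<in> E" "\<And>n. n \<in> E \<Longrightarrow> 2*d < \<bar>n\<bar>"
    and \<alpha>_le: "\<And>z. z \<in> sphere 0 1 \<Longrightarrow> \<bar>\<alpha> z\<bar> \<le> (\<Sum>j\<in>J. \<bar>\<beta> j z\<bar>)"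
    and err: "\<And>z w. z \<in> sphere 0 1 \<Longrightarrow>
      cmod (P z - w * (\<i> * of_real (\<alpha> z) - of_real (((\<alpha> z)\<^sup>2 - (\<Sum>j\<in>J. (\<beta> j z)\<^sup>2) / 2) / 2)))
                \<le> (\<Sum>j\<in>J. cmod (v j - w) * \<bar>\<beta> j z\<bar>) * (1 + 2 * (\<Sum>j\<in>J. \<bar>\<beta> j z\<bar>))"
    by (elim exE conjE meta_impE) (auto simp: insert.prems)
  have tb: "trig_poly_on {-d..d} (\<lambda>z. of_real (\<beta> j z))" using insert.prems by simp
  have "finite (A \<union> E)" using bal \<alpha> balanced_finite trig_poly_on_finite by blast
  then obtain M where M: "M \<ge> 0" "\<And>n. n \<in> A \<Longrightarrow> \<bar>n\<bar> \<le> M" "\<And>n. n \<in> E \<Longrightarrow> \<bar>n\<bar> \<le> M"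
    using finite_int_bound[of "A \<union> E"] by auto
  define K where "K = 2 * M + 4 * d + 1"
  define C :: "complex \<Rightarrow> real" where "C z = Re (z powi K)" for z
  \<comment> \<open>B1 receives the spectrum of S, B2 that of R; M bounds all frequencies used so far.\<close>
  define B1 where "B1 = {n. \<bar>\<bar>n\<bar> - K\<bar> \<le> d}"
  define B2 where "B2 = {n. \<bar>n\<bar> \<le> 2*K + 2*d \<and> M < \<bar>n\<bar> \<and> d < \<bar>\<bar>n\<bar> - K\<bar>}"
  have finB: "finite B1" "finite B2"
    by (rule finite_subset[of _ "{-K-d..K+d}"]; force simp: B1_def)
       (rule finite_subset[of _ "{-2*K-2*d..2*K+2*d}"]; force simp: B2_def)
  have tC: "trig_poly_on {K,-K} (\<lambda>z. of_real (C z))"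
    unfolding C_def by (rule trig_poly_on_Re_powi) auto
  have tS: "trig_poly_on B1 (\<lambda>z. of_real (\<beta> j z * C z))"
    unfolding of_real_mult
    by (rule trig_poly_on_mult[OF tb tC finB(1)]) (use d M(1) in \<open>auto simp: B1_def K_def\<close>)
  define R where "R z = - ((\<beta> j z)\<^sup>2 * ((C z)\<^sup>2 - 1/2)) / 2 - \<alpha> z * \<beta> j z * C z" for z
  have tR: "trig_poly_on B2 (\<lambda>z. of_real (R z))"
  proof -
    have b2: "trig_poly_on {-2*d..2*d} (\<lambda>z. of_real (\<beta> j z) * of_real (\<beta> j z))"
      by (rule trig_poly_on_mult[OF tb tb]) auto
    have tC2: "trig_poly_on {2*K,-(2*K)} (\<lambda>z. of_real (Re (z powi (2*K))))"
      by (rule trig_poly_on_Re_powi) auto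
    have t1: "trig_poly_on B2 (\<lambda>z. (of_real (\<beta> j z) * of_real (\<beta> j z)) * of_real (Re (z powi (2*K))))"
      by (rule trig_poly_on_mult[OF b2 tC2 finB(2)]) (use d M(1) in \<open>auto simp: B2_def K_def\<close>)
    have ab: "trig_poly_on {n. d < \<bar>n\<bar> \<and> \<bar>n\<bar> \<le> M + d} (\<lambda>z. of_real (\<alpha> z) * of_real (\<beta> j z))"
    proof (rule trig_poly_on_mult[OF \<alpha> tb])
      show "finite {n. d < \<bar>n\<bar> \<and> \<bar>n\<bar> \<le> M + d}"
        by (rule finite_subset[of _ "{-M-d..M+d}"]; force)
    qed (use E(2) M(3) in fastforce)
    have t2: "trig_poly_on B2 (\<lambda>z. (of_real (\<alpha> z) * of_real (\<beta> j z)) * of_real (C z))"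
      by (rule trig_poly_on_mult[OF ab tC finB(2)]) (use d M(1) in \<open>auto simp: B2_def K_def\<close>)
    have "trig_poly_on B2 (\<lambda>z. (-1/4) * ((of_real (\<beta> j z) * of_real (\<beta> j z)) * of_real (Re (z powi (2*K))))
        + (-1) * ((of_real (\<alpha> z) * of_real (\<beta> j z)) * of_real (C z)))"
      by (intro trig_poly_on_add trig_poly_on_cmult t1 t2)
    then show ?thesis
    proof (rule trig_poly_on_cong)
      fix z :: complex assume z: "z \<in> sphere 0 1"
      show "of_real (R z) = (-1/4) * ((of_real (\<beta> j z) * of_real (\<beta> j z)) * of_real (Re (z powi (2*K))))
        + (-1) * ((of_real (\<alpha> z) * of_real (\<beta> j z)) * (of_real (C z) :: complex))"
        unfolding R_def C_def Re_powi_double[OF z] by (simp add: power2_eq_square)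
    qed
  qed
  define P' where "P' z = P z + v j * (\<i> * of_real (\<beta> j z * C z) + of_real (R z))" for z
  define \<alpha>' where "\<alpha>' z = \<alpha> z + \<beta> j z * C z" for z
  have "balanced (A \<union> B1) (\<lambda>z. (F z + P z) + (v j * \<i>) * of_real (\<beta> j z * C z))"
    by (rule balanced_add_real[OF bal tS]) (use M d in \<open>force simp: B1_def K_def\<close>)+
  then have "balanced (A \<union> B1 \<union> B2) (\<lambda>z. ((F z + P z) + (v j * \<i>) * of_real (\<beta> j z * C z)) + v j * of_real (R z))"
    by (rule balanced_add_real[OF _ tR]) (use M d in \<open>force simp: B1_def B2_def K_def\<close>)+
  then have bal': "balanced (A \<union> B1 \<union> B2) (\<lambda>z. F z + P' z)"
    by (simp add: P'_def algebra_simps)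
  have t\<alpha>': "trig_poly_on (E \<union> B1) (\<lambda>z. of_real (\<alpha>' z))"
    unfolding \<alpha>'_def of_real_add
    using trig_poly_on_finite[OF \<alpha>] finB(1)
    by (intro trig_poly_on_add trig_poly_on_mono[OF \<alpha>] trig_poly_on_mono[OF tS]) auto
  have E': "\<forall>n\<in>E \<union> B1. -n \<in> E \<union> B1 \<and> 2*d < \<bar>n\<bar>"
    using E M d by (force simp: B1_def K_def)
  have C_le: "\<bar>C z\<bar> \<le> 1" if "z \<in> sphere 0 1" for z
    using Re_powi_sphere_le[OF that] by (simp add: C_def)
  have bC: "\<bar>\<beta> j z * C z\<bar> \<le> \<bar>\<beta> j z\<bar>" if "z \<in> sphere 0 1" for z
    using C_le[OF that] by (simp add: abs_mult mult_left_le)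
  have \<alpha>'_le: "\<forall>z\<in>sphere 0 1. \<bar>\<alpha>' z\<bar> \<le> (\<Sum>j\<in>insert j J. \<bar>\<beta> j z\<bar>)"
  proof
    fix z :: complex assume z: "z \<in> sphere 0 1"
    show "\<bar>\<alpha>' z\<bar> \<le> (\<Sum>j\<in>insert j J. \<bar>\<beta> j z\<bar>)"
      using bC[OF z] \<alpha>_le[OF z] insert.hyps unfolding \<alpha>'_def by simp
  qed
  have err': "cmod (P' z - w * (\<i> * of_real (\<alpha>' z) - of_real (((\<alpha>' z)\<^sup>2 - (\<Sum>j\<in>insert j J. (\<beta> j z)\<^sup>2) / 2) / 2)))
        \<le> (\<Sum>j\<in>insert j J. cmod (v j - w) * \<bar>\<beta> j z\<bar>) * (1 + 2 * (\<Sum>j\<in>insert j J. \<bar>\<beta> j z\<bar>))"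
    if z: "z \<in> sphere 0 1" for z w
  proof -
    define S where "S = (\<Sum>j\<in>J. \<bar>\<beta> j z\<bar>)"
    define V where "V = (\<Sum>j\<in>J. cmod (v j - w) * \<bar>\<beta> j z\<bar>)"
    define b where "b = \<bar>\<beta> j z\<bar>"
    have nn: "0 \<le> S" "0 \<le> V" "0 \<le> b" by (auto simp: S_def V_def b_def intro!: sum_nonneg)
    have "P' z - w * (\<i> * of_real (\<alpha>' z) - of_real (((\<alpha>' z)\<^sup>2 - (\<Sum>j\<in>insert j J. (\<beta> j z)\<^sup>2) / 2) / 2))
      = (P z - w * (\<i> * of_real (\<alpha> z) - of_real (((\<alpha> z)\<^sup>2 - (\<Sum>j\<in>J. (\<beta> j z)\<^sup>2) / 2) / 2)))
        + (v j - w) * (\<i> * of_real (\<beta> j z * C z) + of_real (R z))" (is "_ = ?X + ?Y")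
      using insert.hyps by (simp add: P'_def \<alpha>'_def R_def field_simps power2_eq_square)
    then have "cmod (P' z - w * (\<i> * of_real (\<alpha>' z) - of_real (((\<alpha>' z)\<^sup>2 - (\<Sum>j\<in>insert j J. (\<beta> j z)\<^sup>2) / 2) / 2)))
      \<le> cmod ?X + cmod ?Y" by (simp only: norm_triangle_ineq)
    also have "cmod ?X \<le> V * (1 + 2 * S)" using err[OF z] by (simp add: V_def S_def)
    also have "cmod ?Y \<le> cmod (v j - w) * (b * (1 + 2 * (b + S)))"
    proof -
      have "cmod (\<i> * of_real (\<beta> j z * C z) + of_real (R z)) \<le> \<bar>\<beta> j z * C z\<bar> + \<bar>R z\<bar>"
        using norm_triangle_ineq[of "\<i> * of_real (\<beta> j z * C z)" "of_real (R z)"] by (simp add: norm_mult abs_mult)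
      also have "\<bar>\<beta> j z * C z\<bar> \<le> b" using bC[OF z] by (simp add: b_def)
      also have "\<bar>R z\<bar> \<le> b * b + S * b"
      proof -
        have "(C z)\<^sup>2 \<le> 1" using C_le[OF z] by (simp add: abs_square_le_1)
        then have "\<bar>(C z)\<^sup>2 - 1/2\<bar> \<le> 1" by (smt (verit) field_sum_of_halves zero_le_power2)
        then have "\<bar>(\<beta> j z)\<^sup>2 * ((C z)\<^sup>2 - 1/2)\<bar> \<le> (\<beta> j z)\<^sup>2 * 1"
          unfolding abs_mult by (intro mult_mono) auto
        moreover have "(\<beta> j z)\<^sup>2 = b * b" by (simp add: b_def power2_eq_square)
        moreover have "\<bar>\<alpha> z * \<beta> j z * C z\<bar> \<le> S * b"
        proof -
          have "\<bar>\<alpha> z * \<beta> j z * C z\<bar> = \<bar>\<alpha> z\<bar> * \<bar>\<beta> j z * C z\<bar>" by (simp add: abs_mult)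
          also have "\<dots> \<le> S * b" using bC[OF z] \<alpha>_le[OF z] by (intro mult_mono) (auto simp: S_def b_def nn)
          finally show ?thesis .
        qed
        moreover have "0 \<le> b * b" by simp
        ultimately show ?thesis unfolding R_def by linarith
      qed
      finally have "cmod (\<i> * of_real (\<beta> j z * C z) + of_real (R z)) \<le> b + (b * b + S * b)" by simp
      also have "\<dots> \<le> b * (1 + 2 * (b + S))" using nn by (simp add: algebra_simps)
      finally show ?thesis unfolding norm_mult by (intro mult_left_mono) auto
    qed
    also have "V * (1 + 2 * S) + cmod (v j - w) * (b * (1 + 2 * (b + S))) \<le> (cmod (v j - w) * b + V) * (1 + 2 * (b + S))"
      using nn by (simp add: algebra_simps)
    finally show ?thesis using insert.hyps by (simp add: V_def S_def b_def)
  qed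
  show ?case
    using bal' t\<alpha>' E' \<alpha>'_le err' by blast
qed

section \<open>A partition of unity on the disc\<close>

definition tent :: "real \<Rightarrow> real" where
  "tent x = max 0 (1 - \<bar>x\<bar>)"

lemma tent_nonneg [simp]: "0 \<le> tent x" and tent_le_1: "tent x \<le> 1"
  by (auto simp: tent_def)

lemma sum_two_neighbours:
  fixes x :: real and g :: "int \<Rightarrow> real"
  assumes x: "\<bar>x\<bar> \<le> real N" and g: "\<And>a. 1 \<le> \<bar>x - of_int a\<bar> \<Longrightarrow> g a = 0"
  shows "(\<Sum>a\<in>{-int N - 1..int N + 1}. g a) = g \<lfloor>x\<rfloor> + g (\<lfloor>x\<rfloor> + 1)"
proof -
  have "-int N \<le> \<lfloor>x\<rfloor>" "\<lfloor>x\<rfloor> \<le> int N"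
    using x by (auto simp: le_floor_iff floor_le_iff abs_le_iff)
  then have "(\<Sum>a\<in>{\<lfloor>x\<rfloor>, \<lfloor>x\<rfloor> + 1}. g a) = (\<Sum>a\<in>{-int N - 1..int N + 1}. g a)"
  proof (intro sum.mono_neutral_left ballI)
    fix a assume "a \<in> {-int N - 1..int N + 1} - {\<lfloor>x\<rfloor>, \<lfloor>x\<rfloor> + 1}"
    then have "a < \<lfloor>x\<rfloor> \<or> \<lfloor>x\<rfloor> + 2 \<le> a" by auto
    then have "a + 1 \<le> \<lfloor>x\<rfloor> \<or> \<lfloor>x\<rfloor> + 2 \<le> a" by auto
    then have "1 \<le> \<bar>x - of_int a\<bar>"
      using floor_correct[of x] by linarith
    then show "g a = 0" by (rule g)
  qed auto
  then show ?thesis by simp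
qed

lemma tent_sum:
  assumes "\<bar>x\<bar> \<le> real N"
  shows "(\<Sum>a\<in>{-int N - 1..int N + 1}. tent (x - of_int a)) = 1"
proof -
  have "(\<Sum>a\<in>{-int N - 1..int N + 1}. tent (x - of_int a)) = tent (x - of_int \<lfloor>x\<rfloor>) + tent (x - of_int (\<lfloor>x\<rfloor> + 1))"
    using assms by (rule sum_two_neighbours) (simp add: tent_def)
  also have "\<dots> = 1" using floor_correct[of x] unfolding tent_def of_int_add of_int_1 by linarith
  finally show ?thesis .
qed

lemma sqrt_tent_sum_le:
  assumes "\<bar>x\<bar> \<le> real N"
  shows "(\<Sum>a\<in>{-int N - 1..int N + 1}. sqrt (tent (x - of_int a))) \<le> 2"
proof -
  have "(\<Sum>a\<in>{-int N - 1..int N + 1}. sqrt (tent (x - of_int a)))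
      = sqrt (tent (x - of_int \<lfloor>x\<rfloor>)) + sqrt (tent (x - of_int (\<lfloor>x\<rfloor> + 1)))"
    using assms by (rule sum_two_neighbours) (simp add: tent_def)
  also have "\<dots> \<le> 1 + 1" by (intro add_mono) (simp_all add: tent_le_1)
  finally show ?thesis by simp
qed

text \<open>
  Products of tents over a square grid of mesh \<open>1 / N\<close>. At every point at most four of them do not
  vanish, whatever the mesh; the bound on the sum of the square roots is the form in which this is used.
\<close>

lemma disc_partition:
  assumes e: "0 < (e::real)"
  shows "\<exists>(J :: (int \<times> int) set) \<phi> v. finite J \<and> (\<forall>j. continuous_on UNIV (\<phi> j)) \<and>
     (\<forall>j w. 0 \<le> \<phi> j w \<and> (\<phi> j w \<noteq> 0 \<longrightarrow> cmod (v j - w) \<le> e)) \<and>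
     (\<forall>w. cmod w \<le> 1 \<longrightarrow> (\<Sum>j\<in>J. \<phi> j w) = 1 \<and> (\<Sum>j\<in>J. sqrt (\<phi> j w)) \<le> (4::real))"
proof -
  obtain N :: nat where N: "2 / e < real N" using reals_Archimedean2 by blast
  with e have N0: "0 < real N" by (smt (verit) divide_pos_pos)
  have N2: "2 / real N \<le> e" using N N0 e by (simp add: field_simps)
  define G where "G = {-int N - 1..int N + 1}"
  define \<phi> where "\<phi> = (\<lambda>(a,b) w. tent (real N * Re w - of_int a) * tent (real N * Im w - of_int b))"
  define v where "v = (\<lambda>(a,b). Complex (of_int a / real N) (of_int b / real N))"
  have "continuous_on UNIV (\<phi> j)" for j
    unfolding \<phi>_def tent_def by (cases j) (auto intro!: continuous_intros)
  moreover have "0 \<le> \<phi> j w \<and> (\<phi> j w \<noteq> 0 \<longrightarrow> cmod (v j - w) \<le> e)" for j w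
  proof (intro conjI impI)
    show "0 \<le> \<phi> j w" by (cases j) (simp add: \<phi>_def)
    assume nz: "\<phi> j w \<noteq> 0"
    obtain a b where j: "j = (a, b)" by (cases j)
    have "\<bar>real N * Re w - of_int a\<bar> < 1" "\<bar>real N * Im w - of_int b\<bar> < 1"
      using nz by (auto simp: j \<phi>_def tent_def max_def split: if_splits)
    moreover have "\<bar>of_int k / real N - x\<bar> \<le> 1 / real N" if "\<bar>real N * x - of_int k\<bar> < 1" for k x
    proof -
      have "of_int k / real N - x = - (real N * x - of_int k) / real N" using N0 by (simp add: field_simps)
      then show ?thesis using that N0 by (simp add: divide_le_cancel)
    qed
    ultimately have "\<bar>of_int a / real N - Re w\<bar> \<le> 1 / real N" "\<bar>of_int b / real N - Im w\<bar> \<le> 1 / real N"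
      by blast+
    moreover have "cmod (v j - w) \<le> \<bar>of_int a / real N - Re w\<bar> + \<bar>of_int b / real N - Im w\<bar>"
      using cmod_le[of "v j - w"] by (simp add: j v_def)
    ultimately show "cmod (v j - w) \<le> e" using N2 by linarith
  qed
  moreover have "(\<Sum>j\<in>G \<times> G. \<phi> j w) = 1 \<and> (\<Sum>j\<in>G \<times> G. sqrt (\<phi> j w)) \<le> 4" if w: "cmod w \<le> 1" for w
  proof
    have "\<bar>real N * Re w\<bar> \<le> real N" "\<bar>real N * Im w\<bar> \<le> real N"
      using w abs_Re_le_cmod[of w] abs_Im_le_cmod[of w] N0 by (auto simp: abs_mult intro: mult_left_le)
    note ts = tent_sum[OF this(1)] tent_sum[OF this(2)] and ss = sqrt_tent_sum_le[OF this(1)] sqrt_tent_sum_le[OF this(2)]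
    have "(\<Sum>j\<in>G \<times> G. \<phi> j w) = (\<Sum>a\<in>G. tent (real N * Re w - of_int a)) * (\<Sum>b\<in>G. tent (real N * Im w - of_int b))"
      by (simp add: \<phi>_def sum_product sum.cartesian_product case_prod_unfold)
    then show "(\<Sum>j\<in>G \<times> G. \<phi> j w) = 1"
      using ts by (simp add: G_def)
    have "(\<Sum>j\<in>G \<times> G. sqrt (\<phi> j w)) = (\<Sum>a\<in>G. sqrt (tent (real N * Re w - of_int a))) * (\<Sum>b\<in>G. sqrt (tent (real N * Im w - of_int b)))"
      by (simp add: \<phi>_def sum_product sum.cartesian_product real_sqrt_mult case_prod_unfold)
    also have "\<dots> \<le> 2 * 2"
      using ss unfolding G_def by (intro mult_mono) (auto intro!: sum_nonneg)
    finally show "(\<Sum>j\<in>G \<times> G. sqrt (\<phi> j w)) \<le> 4" by simp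
  qed
  moreover have "finite (G \<times> G)" by (simp add: G_def)
  ultimately show ?thesis by blast
qed

section \<open>Trigonometric approximation\<close>

lemma real_polynomial_function_trig_poly:
  assumes "real_polynomial_function (p :: complex \<Rightarrow> real)"
  shows "\<exists>d\<ge>0. trig_poly_on {-d..d} (\<lambda>z. of_real (p z))"
  using assms
proof induction
  case (linear f)
  have "trig_poly_on {-1..1} (\<lambda>z. Complex (f 1 / 2) (- f \<i> / 2) * z powi 1
      + Complex (f 1 / 2) (f \<i> / 2) * z powi (-1))"
    by (intro trig_poly_on_add trig_poly_on_monom) auto
  then have "trig_poly_on {-1..1} (\<lambda>z. of_real (f z))"
  proof (rule trig_poly_on_cong)
    fix z :: complex assume z: "z \<in> sphere 0 1"
    have "f z = f (Re z *\<^sub>R 1 + Im z *\<^sub>R \<i>)"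
      by (rule arg_cong[of _ _ f]) (simp add: complex_eq_iff)
    also have "\<dots> = Re z * f 1 + Im z * f \<i>"
      by (simp only: linear_add[OF bounded_linear.linear[OF linear]] linear_scale[OF bounded_linear.linear[OF linear]]) simp
    finally have fz: "f z = Re z * f 1 + Im z * f \<i>" .
    have zi: "z powi (-1) = cnj z" using cnj_powi_sphere[OF z, of 1] by simp
    then show "of_real (f z) = Complex (f 1 / 2) (- f \<i> / 2) * z powi 1
      + Complex (f 1 / 2) (f \<i> / 2) * z powi (-1)"
      unfolding fz zi by (simp add: complex_eq_iff field_simps)
  qed
  then show ?case by (intro exI[of _ 1]) auto
next
  case (const c)
  have "trig_poly_on {-0..0} (\<lambda>z. of_real c * z powi 0)" by (rule trig_poly_on_monom) auto
  then show ?case by (intro exI[of _ 0]) auto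
next
  case (add f g)
  then obtain d e where d: "d \<ge> 0" "trig_poly_on {-d..d} (\<lambda>z. of_real (f z))"
    and e: "e \<ge> 0" "trig_poly_on {-e..e} (\<lambda>z. of_real (g z))" by auto
  have "trig_poly_on {-(d+e)..d+e} (\<lambda>z. of_real (f z) + of_real (g z))"
    by (intro trig_poly_on_add trig_poly_on_mono[OF d(2)] trig_poly_on_mono[OF e(2)]) (use d(1) e(1) in auto)
  then show ?case using d(1) e(1) by (intro exI[of _ "d+e"]) auto
next
  case (mult f g)
  then obtain d e where d: "d \<ge> 0" "trig_poly_on {-d..d} (\<lambda>z. of_real (f z))"
    and e: "e \<ge> 0" "trig_poly_on {-e..e} (\<lambda>z. of_real (g z))" by auto
  have "trig_poly_on {-(d+e)..d+e} (\<lambda>z. of_real (f z) * of_real (g z))"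
    by (rule trig_poly_on_mult[OF d(2) e(2)]) auto
  then show ?case using d(1) e(1) by (intro exI[of _ "d+e"]) auto
qed

lemma simultaneous_trig_approx:
  fixes b :: "'j \<Rightarrow> complex \<Rightarrow> real"
  assumes J: "finite J" and b: "\<And>j. j \<in> J \<Longrightarrow> continuous_on (sphere 0 1) (b j)" and t: "0 < t"
  shows "\<exists>\<beta> d. 0 \<le> d \<and> (\<forall>j\<in>J. trig_poly_on {-d..d} (\<lambda>z. of_real (\<beta> j z)) \<and>
           (\<forall>z\<in>sphere 0 1. \<bar>b j z - \<beta> j z\<bar> \<le> t))"
proof -
  have "\<forall>j\<in>J. \<exists>p d. 0 \<le> d \<and> trig_poly_on {-d..d} (\<lambda>z. of_real (p z)) \<and> (\<forall>z\<in>sphere 0 1. \<bar>b j z - p z\<bar> \<le> t)"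
  proof
    fix j assume "j \<in> J"
    then obtain p where "real_polynomial_function p" "\<And>z. z \<in> sphere 0 1 \<Longrightarrow> \<bar>b j z - p z\<bar> < t"
      using Stone_Weierstrass_real_polynomial_function[OF compact_sphere b t] by metis
    with real_polynomial_function_trig_poly[of p] show "\<exists>p d. 0 \<le> d \<and> trig_poly_on {-d..d} (\<lambda>z. of_real (p z)) \<and> (\<forall>z\<in>sphere 0 1. \<bar>b j z - p z\<bar> \<le> t)"
      by (meson less_imp_le)
  qed
  then obtain \<beta> d where \<beta>: "\<And>j. j \<in> J \<Longrightarrow> 0 \<le> d j \<and> trig_poly_on {-d j..d j} (\<lambda>z. of_real (\<beta> j z)) \<and> (\<forall>z\<in>sphere 0 1. \<bar>b j z - \<beta> j z\<bar> \<le> t)"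
    by metis
  define D :: int where "D = (\<Sum>j\<in>J. d j)"
  have dD: "d j \<le> D" if "j \<in> J" for j
    unfolding D_def using J that \<beta> by (intro member_le_sum) auto
  have "0 \<le> D" unfolding D_def using \<beta> by (intro sum_nonneg) auto
  moreover have "trig_poly_on {-D..D} (\<lambda>z. of_real (\<beta> j z))" if "j \<in> J" for j
    using dD[OF that] \<beta>[OF that] trig_poly_on_mono[of "{-d j..d j}" _ "{-D..D}"] by auto
  ultimately show ?thesis using \<beta> by blast
qed

section \<open>Raising the modulus\<close>

text \<open>The linear terms in \<open>a\<^sup>2\<close> cancel: the squared modulus oscillates only to fourth order in \<open>a\<close>.\<close>

lemma norm_square_second_order:
  fixes f :: complex and a q :: real
  shows "(cmod (f + f * (\<i> * of_real a - of_real ((a\<^sup>2 - q) / 2))))\<^sup>2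
    = (cmod f)\<^sup>2 * (1 + q + (a\<^sup>2 - q)\<^sup>2 / 4)"
proof -
  have "f + f * (\<i> * of_real a - of_real ((a\<^sup>2 - q) / 2)) = f * Complex (1 - (a\<^sup>2 - q) / 2) a"
    by (simp add: complex_eq_iff field_simps)
  moreover have "(cmod (Complex (1 - (a\<^sup>2 - q) / 2) a))\<^sup>2 = 1 + q + (a\<^sup>2 - q)\<^sup>2 / 4"
    unfolding cmod_power2 by (simp add: power2_eq_square field_simps)
  ultimately show ?thesis by (simp add: norm_mult power_mult_distrib)
qed

text \<open>
  The amplitude given to the grid node \<open>v j\<close> is \<open>b j z = sqrt (2 q z * \<phi> j (F z))\<close>, so that half the sum of the
  squares is \<open>q\<close>, and \<open>b j z\<close> vanishes unless \<open>v j\<close> is close to \<open>F z\<close>. As at most four amplitudes are nonzero at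
  a point, \<open>a\<close> is bounded by \<open>6 * sqrt q\<close> independently of the fineness of the grid. This gives the constant
  \<open>324 = 36\<^sup>2 / 4\<close> in the fourth-order term, and \<open>24 = 6 + 36 / 2\<close> in the displacement. Everything else
  can be made smaller than \<open>\<epsilon>\<close>.
\<close>

lemma raise_modulus:
  assumes F: "balanced A F" and F1: "\<And>z. z \<in> sphere 0 1 \<Longrightarrow> cmod (F z) \<le> 1"
    and q: "continuous_on (sphere 0 1) q" "\<And>z. z \<in> sphere 0 1 \<Longrightarrow> 0 < q z \<and> q z \<le> 1"
    and \<epsilon>: "0 < \<epsilon>"
  shows "\<exists>A' F'. balanced A' F' \<and> (\<forall>z\<in>sphere 0 1.
           (cmod (F z))\<^sup>2 * (1 + q z) - \<epsilon> \<le> (cmod (F' z))\<^sup>2 \<and>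
           (cmod (F' z))\<^sup>2 \<le> (cmod (F z))\<^sup>2 * (1 + q z + 324 * (q z)\<^sup>2) + \<epsilon> \<and>
           cmod (F' z - F z) \<le> 24 * sqrt (q z) + \<epsilon>)"
proof -
  obtain q0 where q0: "0 < q0" "\<And>z. z \<in> sphere 0 1 \<Longrightarrow> q0 \<le> q z"
    using continuous_attains_inf[OF compact_sphere _ q(1)] q(2) by (metis sphere_eq_empty zero_less_one not_less_iff_gr_or_eq)
  define \<eta> where "\<eta> = min 1 (\<epsilon> / 20000)"
  have \<eta>: "0 < \<eta>" "\<eta> \<le> 1" "20000 * \<eta> \<le> \<epsilon>" using \<epsilon> by (auto simp: \<eta>_def)
  obtain J :: "(int \<times> int) set" and \<phi> v where J: "finite J" and \<phi>c: "\<And>j. continuous_on UNIV (\<phi> j)"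
    and \<phi>: "\<And>j w. 0 \<le> \<phi> j w" "\<And>j w. \<phi> j w \<noteq> 0 \<Longrightarrow> cmod (v j - w) \<le> \<eta>"
    and \<phi>s: "\<And>w. cmod w \<le> 1 \<Longrightarrow> (\<Sum>j\<in>J. \<phi> j w) = 1" "\<And>w. cmod w \<le> 1 \<Longrightarrow> (\<Sum>j\<in>J. sqrt (\<phi> j w)) \<le> (4::real)"
    using disc_partition[OF \<eta>(1)] by blast
  define V where "V = (\<Sum>j\<in>J. cmod (v j)) + 1"
  have V1: "1 \<le> V" by (auto simp: V_def intro!: sum_nonneg)
  have V: "cmod (v j - w) \<le> V" if "j \<in> J" "cmod w \<le> 1" for j w
  proof -
    have "cmod (v j) \<le> (\<Sum>j\<in>J. cmod (v j))" using J that by (intro member_le_sum) auto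
    then show ?thesis using norm_triangle_ineq4[of "v j" w] that(2) unfolding V_def by linarith
  qed
  define n where "n = real (card J)"
  have n0: "0 \<le> n" by (simp add: n_def)
  \<comment> \<open>The error allowed in each trigonometric approximation: negligible even when summed over all the
    nodes with weights up to V, relative to both \<eta> and the smallest value of sqrt q.\<close>
  define \<tau> where "\<tau> = min \<eta> (sqrt q0) / (4 * (n + 1) * V)"
  have \<tau>0: "0 < \<tau>" using \<eta> q0 n0 V1 by (auto simp: \<tau>_def intro!: divide_pos_pos)
  have "4 * (n + 1) * V * \<tau> = min \<eta> (sqrt q0)" using n0 V1 by (simp add: \<tau>_def)
  then have *: "4 * n * V * \<tau> + 4 * V * \<tau> = min \<eta> (sqrt q0)" by (simp add: algebra_simps)
  have nV: "n * \<tau> \<le> n * V * \<tau>" "\<tau> \<le> V * \<tau>" using V1 n0 \<tau>0 by (auto simp: mult_le_cancel_right mult_le_cancel_left1 mult_le_cancel_left2)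
  have "0 \<le> n * V * \<tau>" "0 \<le> V * \<tau>" using V1 n0 \<tau>0 by auto
  with * nV have \<tau>: "4 * (n * V * \<tau>) \<le> \<eta>" "4 * (n * \<tau>) \<le> \<eta>" "4 * (n * \<tau>) \<le> sqrt q0" "4 * \<tau> \<le> 1"
    using \<eta> by (auto simp: min_def split: if_splits)
  define b where "b j z = sqrt (2 * q z * \<phi> j (F z))" for j z
  have "continuous_on (sphere 0 1) (b j)" for j
    unfolding b_def
    by (intro continuous_intros q continuous_on_compose2[OF \<phi>c balanced_continuous[OF F]]) auto
  then obtain \<beta> d where d: "0 \<le> d" and \<beta>t: "\<And>j. j \<in> J \<Longrightarrow> trig_poly_on {-d..d} (\<lambda>z. of_real (\<beta> j z))"
    and \<beta>b: "\<And>j z. j \<in> J \<Longrightarrow> z \<in> sphere 0 1 \<Longrightarrow> \<bar>b j z - \<beta> j z\<bar> \<le> \<tau>"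
    using simultaneous_trig_approx[OF J _ \<tau>0, of b] by blast
  obtain A' P E \<alpha> where bal: "balanced A' (\<lambda>z. F z + P z)"
    and \<alpha>: "\<And>z. z \<in> sphere 0 1 \<Longrightarrow> \<bar>\<alpha> z\<bar> \<le> (\<Sum>j\<in>J. \<bar>\<beta> j z\<bar>)"
    and err: "\<And>z w. z \<in> sphere 0 1 \<Longrightarrow>
      cmod (P z - w * (\<i> * of_real (\<alpha> z) - of_real (((\<alpha> z)\<^sup>2 - (\<Sum>j\<in>J. (\<beta> j z)\<^sup>2) / 2) / 2)))
                \<le> (\<Sum>j\<in>J. cmod (v j - w) * \<bar>\<beta> j z\<bar>) * (1 + 2 * (\<Sum>j\<in>J. \<bar>\<beta> j z\<bar>))"
    using modulate[where \<beta> = \<beta> and v = v, OF J F \<beta>t d] by blast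
  show ?thesis
  proof (intro exI conjI ballI)
    show "balanced A' (\<lambda>z. F z + P z)" by (rule bal)
    fix z :: complex assume z: "z \<in> sphere 0 1"
    define f where "f = F z"
    define s where "s = sqrt (q z)"
    define a where "a = \<alpha> z"
    define B where "B = (\<Sum>j\<in>J. \<bar>\<beta> j z\<bar>)"
    define Q where "Q = (\<Sum>j\<in>J. (\<beta> j z)\<^sup>2) / 2"
    define W where "W = (\<Sum>j\<in>J. cmod (v j - f) * \<bar>\<beta> j z\<bar>)"
    define G where "G = f + f * (\<i> * of_real a - of_real ((a\<^sup>2 - Q) / 2))"
    define e1 where "e1 = F z + P z - G"
    have f1: "cmod f \<le> 1" using F1[OF z] by (simp add: f_def)
    have s: "0 < s" "s \<le> 1" "s\<^sup>2 = q z" "sqrt q0 \<le> s" using q(2)[OF z] q0(2)[OF z] by (auto simp: s_def)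
    have b0: "0 \<le> b j z" for j using \<phi>(1) q(2)[OF z] by (simp add: b_def)
    have bs: "b j z = sqrt 2 * s * sqrt (\<phi> j f)" for j by (simp add: b_def s_def f_def real_sqrt_mult)
    have "(\<Sum>j\<in>J. b j z) = sqrt 2 * s * (\<Sum>j\<in>J. sqrt (\<phi> j f))" by (simp add: bs sum_distrib_left)
    also have "\<dots> \<le> (1.42 * s) * 4"
    proof (intro mult_mono)
      show "sqrt 2 \<le> 1.42" by (rule real_le_lsqrt) (auto simp: power2_eq_square)
    qed (use s \<phi>s(2)[OF f1] \<phi>(1) in \<open>auto intro!: sum_nonneg\<close>)
    finally have sb: "(\<Sum>j\<in>J. b j z) \<le> 5.7 * s" using s by simp
    have sb2: "(\<Sum>j\<in>J. (b j z)\<^sup>2) = 2 * q z"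
    proof -
      have "(b j z)\<^sup>2 = 2 * q z * \<phi> j f" for j using \<phi>(1) q(2)[OF z] by (simp add: b_def f_def)
      then show ?thesis using \<phi>s(1)[OF f1] by (simp add: sum_distrib_left[symmetric])
    qed
    have \<beta>le: "\<bar>\<beta> j z\<bar> \<le> b j z + \<tau>" if "j \<in> J" for j using \<beta>b[OF that z] b0[of j] by linarith
    have "B \<le> (\<Sum>j\<in>J. b j z + \<tau>)" unfolding B_def by (intro sum_mono \<beta>le)
    also have "\<dots> = (\<Sum>j\<in>J. b j z) + n * \<tau>" by (simp add: sum.distrib n_def)
    finally have B6: "B \<le> 6 * s" using sb \<tau>(3) s by linarith
    have B0: "0 \<le> B" by (auto simp: B_def intro!: sum_nonneg)
    have "W \<le> (\<Sum>j\<in>J. \<eta> * b j z + V * \<tau>)" unfolding W_def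
    proof (rule sum_mono)
      fix j assume j: "j \<in> J"
      have "cmod (v j - f) * \<bar>\<beta> j z\<bar> \<le> cmod (v j - f) * b j z + cmod (v j - f) * \<tau>"
        using \<beta>le[OF j] by (simp add: distrib_left[symmetric] mult_left_mono)
      also have "cmod (v j - f) * b j z \<le> \<eta> * b j z"
      proof (cases "\<phi> j f = 0")
        case False
        then show ?thesis using \<phi>(2)[of j f] b0[of j] by (intro mult_right_mono) auto
      qed (simp add: bs)
      also have "cmod (v j - f) * \<tau> \<le> V * \<tau>" using V[OF j f1] \<tau>0 by simp
      finally show "cmod (v j - f) * \<bar>\<beta> j z\<bar> \<le> \<eta> * b j z + V * \<tau>" by simp
    qed
    also have "\<dots> = \<eta> * (\<Sum>j\<in>J. b j z) + n * V * \<tau>" by (simp add: sum.distrib sum_distrib_left n_def)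
    also have "\<dots> \<le> \<eta> * 5.7 + \<eta>" using sb s \<eta> \<tau>(1) by (intro add_mono mult_left_mono) linarith+
    finally have W: "W \<le> 7 * \<eta>" using \<eta> by simp
    have Qq: "\<bar>Q - q z\<bar> \<le> \<eta>"
    proof -
      have "\<bar>(\<beta> j z)\<^sup>2 - (b j z)\<^sup>2\<bar> \<le> 8 * \<tau>" if j: "j \<in> J" for j
      proof -
        have "(b j z)\<^sup>2 \<le> (\<Sum>j\<in>J. (b j z)\<^sup>2)" using J j by (intro member_le_sum) auto
        then have "(b j z)\<^sup>2 \<le> 2\<^sup>2" using sb2 q(2)[OF z] by simp
        then have "b j z \<le> 2" by (rule power2_le_imp_le) simp
        then have "\<bar>\<beta> j z + b j z\<bar> \<le> 8" using \<beta>le[OF j] \<tau>(4) b0[of j] by linarith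
        then have "\<bar>\<beta> j z - b j z\<bar> * \<bar>\<beta> j z + b j z\<bar> \<le> \<tau> * 8"
          using \<beta>b[OF j z] by (intro mult_mono) auto
        then show ?thesis by (simp add: abs_mult[symmetric] power2_eq_square algebra_simps)
      qed
      then have "\<bar>\<Sum>j\<in>J. (\<beta> j z)\<^sup>2 - (b j z)\<^sup>2\<bar> \<le> n * (8 * \<tau>)"
        unfolding n_def by (intro order.trans[OF sum_abs] sum_bounded_above) auto
      then have "\<bar>2 * Q - 2 * q z\<bar> \<le> 8 * (n * \<tau>)" by (simp add: sum_subtractf sb2 Q_def)
      then show ?thesis using \<tau>(2) by linarith
    qed
    have Q0: "0 \<le> Q" by (auto simp: Q_def intro!: sum_nonneg)
    have sq36: "(6 * s)\<^sup>2 = 36 * q z" using s(3) by (simp add: power_mult_distrib)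
    have "(\<Sum>j\<in>J. (\<beta> j z)\<^sup>2) \<le> B\<^sup>2"
    proof -
      have "(\<Sum>j\<in>J. (\<beta> j z)\<^sup>2) = (\<Sum>j\<in>J. \<bar>\<beta> j z\<bar> * \<bar>\<beta> j z\<bar>)" by (simp add: power2_eq_square)
      also have "\<dots> \<le> (\<Sum>j\<in>J. \<bar>\<beta> j z\<bar> * B)"
        unfolding B_def using J by (intro sum_mono mult_left_mono member_le_sum) auto
      finally show ?thesis by (simp add: B_def sum_distrib_right power2_eq_square)
    qed
    also have "\<dots> \<le> (6 * s)\<^sup>2" using B6 B0 by (rule power_mono)
    finally have Q36: "Q \<le> 36 * q z" using q(2)[OF z] unfolding sq36 Q_def by linarith
    have aB: "\<bar>a\<bar> \<le> 6 * s" using \<alpha>[OF z] B6 by (simp add: a_def B_def)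
    then have a36: "a\<^sup>2 \<le> 36 * q z" using sq36 by (metis abs_ge_zero power2_abs power_mono)
    have aQ: "\<bar>a\<^sup>2 - Q\<bar> \<le> 36 * q z" using a36 Q36 Q0 by (smt (verit) zero_le_power2)
    have "(a\<^sup>2 - Q)\<^sup>2 \<le> (36 * q z)\<^sup>2" using aQ by (metis abs_ge_zero power2_abs power_mono)
    then have aQ2: "(a\<^sup>2 - Q)\<^sup>2 / 4 \<le> 324 * (q z)\<^sup>2" by (simp add: power_mult_distrib)
    have e1: "cmod e1 \<le> 100 * \<eta>"
    proof -
      have "cmod e1 \<le> W * (1 + 2 * B)"
        using err[OF z, of f] by (simp add: e1_def G_def f_def W_def B_def Q_def a_def)
      also have "\<dots> \<le> (7 * \<eta>) * (1 + 2 * 6)"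
        using W B6 B0 s \<eta> by (intro mult_mono) auto
      finally show ?thesis using \<eta> by simp
    qed
    have qs: "q z \<le> s" using s by (simp add: s(3)[symmetric] power2_eq_square)
    have Gf: "cmod (G - f) \<le> 24 * s"
    proof -
      have "cmod (\<i> * of_real a - of_real ((a\<^sup>2 - Q) / 2)) \<le> \<bar>a\<bar> + \<bar>(a\<^sup>2 - Q) / 2\<bar>"
        by (rule order.trans[OF norm_triangle_ineq4]) (simp only: norm_mult norm_ii norm_of_real mult_1_left order_refl)
      also have "\<bar>(a\<^sup>2 - Q) / 2\<bar> = \<bar>a\<^sup>2 - Q\<bar> / 2" by (simp add: abs_divide)
      also have "\<bar>a\<bar> + \<bar>a\<^sup>2 - Q\<bar> / 2 \<le> 24 * s" using add_mono[OF aB divide_right_mono[OF aQ, of 2]] qs by simp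
      finally have "cmod f * cmod (\<i> * of_real a - of_real ((a\<^sup>2 - Q) / 2)) \<le> 1 * (24 * s)"
        using f1 by (intro mult_mono) auto
      then show ?thesis by (simp add: G_def norm_mult)
    qed
    have "F z + P z - F z = (G - f) + e1" by (simp add: e1_def f_def)
    then have "cmod (F z + P z - F z) \<le> cmod (G - f) + cmod e1"
      by (simp only: norm_triangle_ineq)
    then show "cmod (F z + P z - F z) \<le> 24 * sqrt (q z) + \<epsilon>"
      using Gf e1 \<eta> unfolding s_def by linarith
    have G25: "cmod G \<le> 25" using Gf f1 s norm_triangle_ineq[of "G - f" f] by simp
    have diff: "\<bar>(cmod (F z + P z))\<^sup>2 - (cmod G)\<^sup>2\<bar> \<le> 15000 * \<eta>"
    proof -
      have 1: "\<bar>cmod (F z + P z) - cmod G\<bar> \<le> cmod e1"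
        unfolding e1_def by (rule norm_triangle_ineq3)
      then have 2: "\<bar>cmod (F z + P z) + cmod G\<bar> \<le> 150" using G25 e1 \<eta> by simp
      have "\<bar>cmod (F z + P z) - cmod G\<bar> * \<bar>cmod (F z + P z) + cmod G\<bar> \<le> (100 * \<eta>) * 150"
        using 1 2 e1 \<eta> by (intro mult_mono) auto
      moreover have "(cmod (F z + P z))\<^sup>2 - (cmod G)\<^sup>2 = (cmod (F z + P z) - cmod G) * (cmod (F z + P z) + cmod G)"
        by (simp add: power2_eq_square algebra_simps)
      ultimately show ?thesis by (simp only: abs_mult)
    qed
    have G2: "(cmod G)\<^sup>2 = (cmod f)\<^sup>2 * (1 + Q + (a\<^sup>2 - Q)\<^sup>2 / 4)"
      unfolding G_def by (rule norm_square_second_order)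
    have f2: "(cmod f)\<^sup>2 \<le> 1" using f1 by (simp add: abs_square_le_1)
    have f\<eta>: "(cmod f)\<^sup>2 * \<eta> \<le> \<eta>" using f2 \<eta> by (simp add: mult_left_le_one_le)
    have "(cmod f)\<^sup>2 * (1 + q z) - \<eta> \<le> (cmod f)\<^sup>2 * (1 + q z - \<eta>)" using f\<eta> by (simp add: algebra_simps)
    also have "\<dots> \<le> (cmod G)\<^sup>2" unfolding G2 using Qq
      by (intro mult_left_mono) (auto simp: abs_if intro!: add_increasing2 split: if_splits)
    finally show "(cmod (F z))\<^sup>2 * (1 + q z) - \<epsilon> \<le> (cmod (F z + P z))\<^sup>2"
      using diff \<eta> by (simp add: f_def)
    have "(cmod G)\<^sup>2 \<le> (cmod f)\<^sup>2 * (1 + q z + 324 * (q z)\<^sup>2 + \<eta>)"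
      unfolding G2 using Qq aQ2 by (intro mult_left_mono) auto
    also have "\<dots> \<le> (cmod f)\<^sup>2 * (1 + q z + 324 * (q z)\<^sup>2) + \<eta>" using f\<eta> by (simp add: algebra_simps)
    finally show "(cmod (F z + P z))\<^sup>2 \<le> (cmod (F z))\<^sup>2 * (1 + q z + 324 * (q z)\<^sup>2) + \<epsilon>"
      using diff \<eta> by (simp add: f_def)
  qed
qed

section \<open>Iteration\<close>

text \<open>
  With \<open>q = \<kappa> D / |F|\<^sup>2\<close>, where \<open>D = 1 - |F|\<^sup>2\<close>, the main term of the squared modulus becomes \<open>|F|\<^sup>2 + \<kappa> D\<close>.
  The choice of \<open>\<kappa>\<close> serves two purposes: the fourth-order error \<open>324 |F|\<^sup>2 q\<^sup>2\<close> is less than \<open>\<kappa> D\<close>, so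
  that the modulus stays below 1, and for \<open>d \<le> 1\<close> the displacement is less than \<open>sqrt m \<le> |F|\<close>, so that the homotopy class
  is preserved. The lower bound \<open>m\<close> is inherited, hence \<open>\<kappa>\<close> stays the same along the iteration.
\<close>

lemma contraction_step:
  assumes F: "balanced A F" and m: "0 < m" "m \<le> 1" and \<kappa>_def: "\<kappa> = m\<^sup>2 / 1000"
    and Fm: "\<And>z. z \<in> sphere 0 1 \<Longrightarrow> m \<le> (cmod (F z))\<^sup>2"
    and Fd: "\<And>z. z \<in> sphere 0 1 \<Longrightarrow> 0 < 1 - (cmod (F z))\<^sup>2 \<and> 1 - (cmod (F z))\<^sup>2 \<le> d"
  shows "\<exists>A' F'. balanced A' F' \<and> (\<forall>z\<in>sphere 0 1. m \<le> (cmod (F' z))\<^sup>2 \<and>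
           0 < 1 - (cmod (F' z))\<^sup>2 \<and> 1 - (cmod (F' z))\<^sup>2 \<le> (1 - \<kappa> / 2) * d \<and>
           cmod (F' z - F z) \<le> 4 / 5 * sqrt (m * d))"
proof -
  define D where "D z = 1 - (cmod (F z))\<^sup>2" for z
  have contD: "continuous_on (sphere 0 1) D"
    unfolding D_def by (intro continuous_intros balanced_continuous[OF F])
  obtain D0 where D0: "0 < D0" "\<And>z. z \<in> sphere 0 1 \<Longrightarrow> D0 \<le> D z"
    using continuous_attains_inf[OF compact_sphere _ contD] Fd unfolding D_def
    by (metis sphere_eq_empty zero_less_one not_less_iff_gr_or_eq)
  have m2: "m\<^sup>2 \<le> m" "m\<^sup>2 \<le> 1" using m by (auto simp: power2_eq_square mult_left_le mult_le_one)
  have \<kappa>: "0 < \<kappa>" "\<kappa> \<le> m / 1000" "\<kappa> \<le> 1/1000" using m m2 by (auto simp: \<kappa>_def)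
  have D1: "D z < 1" if "z \<in> sphere 0 1" for z using Fm[OF that] m unfolding D_def by linarith
  have D01: "D0 < 1" using D0(2)[of 1] D1[of 1] by simp
  define q where "q z = \<kappa> * D z / (cmod (F z))\<^sup>2" for z
  have F2: "0 < (cmod (F z))\<^sup>2" "(cmod (F z))\<^sup>2 \<le> 1" if "z \<in> sphere 0 1" for z
    using Fm[OF that] m Fd[OF that] by linarith+
  have contq: "continuous_on (sphere 0 1) q"
    unfolding q_def using F2(1) by (intro continuous_intros contD balanced_continuous[OF F]) force
  have q_up: "q z \<le> \<kappa> * D z / m" and q_lo: "\<kappa> * D z \<le> q z" if z: "z \<in> sphere 0 1" for z
  proof -
    have D: "0 \<le> \<kappa> * D z" using \<kappa> D0 D0(2)[OF z] by simp
    show "q z \<le> \<kappa> * D z / m" unfolding q_def using Fm[OF z] m D F2(1)[OF z] by (intro divide_left_mono mult_pos_pos) auto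
    show "\<kappa> * D z \<le> q z" unfolding q_def using F2[OF z] mult_left_le[OF F2(2)[OF z] D] by (simp add: le_divide_eq)
  qed
  have q01: "0 < q z \<and> q z \<le> 1" if z: "z \<in> sphere 0 1" for z
  proof
    have "0 < \<kappa> * D z" using \<kappa> D0(1) D0(2)[OF z] by simp
    then show "0 < q z" using q_lo[OF z] by linarith
    have "\<kappa> * D z \<le> m * 1"
      using \<kappa> m D1[OF z] D0(1) D0(2)[OF z] by (intro mult_mono) auto
    then have "\<kappa> * D z / m \<le> 1" using m by simp
    then show "q z \<le> 1" using q_up[OF z] by linarith
  qed
  have F1: "cmod (F z) \<le> 1" if "z \<in> sphere 0 1" for z
    using F2(2)[OF that] by (simp add: abs_square_le_1)
  have \<epsilon>: "0 < \<kappa> * D0 / 4" using \<kappa> D0 by simp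
  obtain A' F' where bal: "balanced A' F'"
    and lo: "\<And>z. z \<in> sphere 0 1 \<Longrightarrow> (cmod (F z))\<^sup>2 * (1 + q z) - \<kappa> * D0 / 4 \<le> (cmod (F' z))\<^sup>2"
    and up: "\<And>z. z \<in> sphere 0 1 \<Longrightarrow> (cmod (F' z))\<^sup>2 \<le> (cmod (F z))\<^sup>2 * (1 + q z + 324 * (q z)\<^sup>2) + \<kappa> * D0 / 4"
    and di: "\<And>z. z \<in> sphere 0 1 \<Longrightarrow> cmod (F' z - F z) \<le> 24 * sqrt (q z) + \<kappa> * D0 / 4"
    using raise_modulus[OF F F1 contq q01 \<epsilon>] by blast
  have "m \<le> (cmod (F' z))\<^sup>2 \<and> 0 < 1 - (cmod (F' z))\<^sup>2 \<and> 1 - (cmod (F' z))\<^sup>2 \<le> (1 - \<kappa> / 2) * d \<and>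
           cmod (F' z - F z) \<le> 4 / 5 * sqrt (m * d)" if z: "z \<in> sphere 0 1" for z
  proof (intro conjI)
    have Dz: "D0 \<le> D z" "D z \<le> d" "0 < D z" using D0(2)[OF z] D0(1) Fd[OF z] by (auto simp: D_def)
    have FD: "(cmod (F z))\<^sup>2 = 1 - D z" by (simp add: D_def)
    have kD: "\<kappa> * D0 \<le> \<kappa> * D z" using Dz \<kappa> by simp
    have kDD: "\<kappa> * D z \<le> D z / 1000" using mult_right_mono[OF \<kappa>(3), of "D z"] Dz by simp
    have Fq: "(cmod (F z))\<^sup>2 * q z = \<kappa> * D z" using F2(1)[OF z] by (simp add: q_def)
    have kD0: "0 < \<kappa> * D0" using \<kappa> D0 by simp
    have lo': "(cmod (F z))\<^sup>2 + \<kappa> * D z - \<kappa> * D0 / 4 \<le> (cmod (F' z))\<^sup>2"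
      using lo[OF z] Fq by (simp add: algebra_simps)
    then show "m \<le> (cmod (F' z))\<^sup>2" using Fm[OF z] kD kD0 by linarith
    have "\<kappa> * D z / m \<le> D z / 1000" using mult_right_mono[OF \<kappa>(2), of "D z"] Dz m by (simp add: field_simps)
    then have "q z \<le> 1 / 1000" using q_up[OF z] D1[OF z] by linarith
    then have "\<kappa> * D z * (324 * q z) \<le> \<kappa> * D z * 1" using \<kappa> Dz by (intro mult_left_mono) auto
    moreover have "(cmod (F z))\<^sup>2 * (1 + q z + 324 * (q z)\<^sup>2)
        = (cmod (F z))\<^sup>2 + (cmod (F z))\<^sup>2 * q z + ((cmod (F z))\<^sup>2 * q z) * (324 * q z)"
      by (simp add: power2_eq_square algebra_simps)
    ultimately have "(cmod (F' z))\<^sup>2 \<le> (cmod (F z))\<^sup>2 + 2 * (\<kappa> * D z) + \<kappa> * D0 / 4"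
      using up[OF z] unfolding Fq by linarith
    then show "0 < 1 - (cmod (F' z))\<^sup>2" using kD kDD Dz unfolding FD by linarith
    have "1 - (cmod (F' z))\<^sup>2 \<le> D z - \<kappa> * D z / 2" using lo' kD kD0 unfolding FD by linarith
    also have "\<dots> = (1 - \<kappa> / 2) * D z" by (simp add: algebra_simps)
    also have "\<dots> \<le> (1 - \<kappa> / 2) * d" using Dz \<kappa> by (intro mult_left_mono) auto
    finally show "1 - (cmod (F' z))\<^sup>2 \<le> (1 - \<kappa> / 2) * d" .
    have "\<kappa> * D0 \<le> 1 * 1" using \<kappa> D01 D0 by (intro mult_mono) auto
    then have "(\<kappa> * D0) * (\<kappa> * D0) \<le> (\<kappa> * D0) * 1" using kD0 by (intro mult_left_mono) auto
    also have "\<dots> \<le> q z" using kD q_lo[OF z] by simp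
    finally have "\<kappa> * D0 \<le> sqrt (q z)" by (intro real_le_rsqrt) (simp add: power2_eq_square)
    then have "cmod (F' z - F z) \<le> 25 * sqrt (q z)" using di[OF z] kD0 by linarith
    also have "sqrt (q z) \<le> sqrt (m * d / 1000)"
    proof -
      have "\<kappa> * D z / m = m * D z / 1000" using m by (simp add: \<kappa>_def power2_eq_square)
      also have "\<dots> \<le> m * d / 1000" using Dz m by simp
      finally show ?thesis using q_up[OF z] by (intro real_sqrt_le_mono) (rule order.trans)
    qed
    also have "25 * sqrt (m * d / 1000) = sqrt (625 * (m * d / 1000))"
      by (subst real_sqrt_mult) (use real_sqrt_abs[of 25] in simp)
    also have "\<dots> \<le> sqrt ((4/5)\<^sup>2 * (m * d))"
      using m Dz by (intro real_sqrt_le_mono) (simp add: power2_eq_square)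
    also have "\<dots> = 4 / 5 * sqrt (m * d)" by (subst real_sqrt_mult) simp
    finally show "cmod (F' z - F z) \<le> 4 / 5 * sqrt (m * d)" by simp
  qed
  with bal show ?thesis by blast
qed

lemma homotopic_nonzero_near:
  fixes F G :: "complex \<Rightarrow> complex"
  assumes "continuous_on S F" "continuous_on S G" "\<And>z. z \<in> S \<Longrightarrow> cmod (G z - F z) < cmod (F z)"
  shows "homotopic_with_canon (\<lambda>_. True) S (-{0}) F G"
proof (rule homotopic_with_linear[OF assms(1,2)])
  fix z assume "z \<in> S"
  then have "0 \<notin> closed_segment (F z) (G z)"
    using segment_bound(1)[of 0 "F z" "G z"] assms(3)[of z] by auto
  then show "closed_segment (F z) (G z) \<subseteq> -{0}" by auto
qed

text \<open>
  Iterating \<open>contraction_step\<close>, the displacements are dominated by a geometric series of ratio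
  \<open>sqrt (1 - \<kappa> / 2)\<close>. The homotopy class is controlled step by step up to an index from which the limit is
  uniformly closer than \<open>sqrt m\<close>.
\<close>

lemma unimodular_limit:
  assumes F: "balanced A F" and F1: "\<And>z. z \<in> sphere 0 1 \<Longrightarrow> F z \<noteq> 0 \<and> cmod (F z) < 1"
  shows "\<exists>f. continuous_on (sphere 0 1) f \<and> (\<forall>z\<in>sphere 0 1. cmod (f z) = 1) \<and>
    homotopic_with_canon (\<lambda>_. True) (sphere 0 1) (-{0}) F f \<and>
    (\<forall>e>0. \<exists>A' G. balanced A' G \<and> (\<forall>z\<in>sphere 0 1. cmod (f z - G z) \<le> e))"
proof -
  have "continuous_on (sphere 0 1) (\<lambda>z. (cmod (F z))\<^sup>2)"
    by (intro continuous_intros balanced_continuous[OF F])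
  then obtain m where m: "0 < m" "\<And>z. z \<in> sphere 0 1 \<Longrightarrow> m \<le> (cmod (F z))\<^sup>2"
    using continuous_attains_inf[OF compact_sphere, of 0 1 "\<lambda>z. (cmod (F z))\<^sup>2"] F1
    by (metis sphere_eq_empty zero_less_one not_less_iff_gr_or_eq zero_less_norm_iff zero_less_power)
  have F2: "(cmod (F z))\<^sup>2 < 1" if "z \<in> sphere 0 1" for z
    using F1[OF that] by (simp add: abs_square_less_1)
  have m1: "m \<le> 1" using m(2)[of 1] F2[of 1] by simp
  define \<kappa> where "\<kappa> = m\<^sup>2 / 1000"
  have \<kappa>: "0 < \<kappa>" "\<kappa> \<le> 1" using m m1 by (auto simp: \<kappa>_def power_le_one intro: order.trans[of _ 1])
  define d where "d n = (1 - \<kappa> / 2) ^ n" for n :: nat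
  have d0: "0 < d n" "d n \<le> 1" for n using \<kappa> by (auto simp: d_def intro: power_le_one)
  define P where "P n X \<longleftrightarrow> balanced (fst X) (snd X) \<and> (\<forall>z\<in>sphere 0 1. m \<le> (cmod (snd X z))\<^sup>2 \<and>
     0 < 1 - (cmod (snd X z))\<^sup>2 \<and> 1 - (cmod (snd X z))\<^sup>2 \<le> d n) \<and> (n = 0 \<longrightarrow> X = (A, F))"
    for n :: nat and X :: "int set \<times> (complex \<Rightarrow> complex)"
  define Q where "Q n X Y \<longleftrightarrow> (\<forall>z\<in>sphere 0 1. cmod (snd Y z - snd X z) \<le> 4 / 5 * sqrt (m * d n))"
    for n :: nat and X Y :: "int set \<times> (complex \<Rightarrow> complex)"
  have "\<exists>X. \<forall>n. P n (X n) \<and> Q n (X n) (X (Suc n))"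
  proof (rule dependent_nat_choice)
    show "\<exists>X. P 0 X" using F m F2 by (intro exI[of _ "(A, F)"]) (auto simp: P_def d_def)
    fix X n assume "P n X"
    then obtain A' F' where "balanced A' F'" "\<forall>z\<in>sphere 0 1. m \<le> (cmod (F' z))\<^sup>2 \<and>
           0 < 1 - (cmod (F' z))\<^sup>2 \<and> 1 - (cmod (F' z))\<^sup>2 \<le> (1 - \<kappa> / 2) * d n \<and>
           cmod (F' z - snd X z) \<le> 4 / 5 * sqrt (m * d n)"
      using contraction_step[of "fst X" "snd X" m \<kappa> "d n"] m(1) m1 \<kappa>_def unfolding P_def by blast
    then show "\<exists>Y. P (Suc n) Y \<and> Q n X Y"
      by (intro exI[of _ "(A', F')"]) (auto simp: P_def Q_def d_def)
  qed
  then obtain X where X: "\<And>n. P n (X n)" "\<And>n. Q n (X n) (X (Suc n))" by blast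
  define G where "G n = snd (X n)" for n
  have bal: "balanced (fst (X n)) (G n)" for n using X(1)[of n] by (simp add: P_def G_def)
  have G0: "G 0 = F" using X(1)[of 0] by (simp add: P_def G_def)
  have Gm: "m \<le> (cmod (G n z))\<^sup>2" and Gd: "\<bar>1 - (cmod (G n z))\<^sup>2\<bar> \<le> d n" if "z \<in> sphere 0 1" for n z
    using X(1)[of n] that by (force simp: P_def G_def abs_le_iff)+
  have Gs: "sqrt m \<le> cmod (G n z)" if "z \<in> sphere 0 1" for n z
    using Gm[OF that] by (rule real_le_lsqrt[rotated]) auto
  have step: "cmod (G (Suc n) z - G n z) \<le> 4 / 5 * sqrt (m * d n)" if "z \<in> sphere 0 1" for n z
    using X(2)[of n] that by (auto simp: Q_def G_def)
  have cont: "continuous_on (sphere 0 1) (G n)" for n using balanced_continuous[OF bal] .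
  have hom: "homotopic_with_canon (\<lambda>_. True) (sphere 0 1) (-{0}) F (G n)" for n
  proof (induction n)
    case 0
    have "homotopic_with_canon (\<lambda>_. True) (sphere 0 1) (-{0}) F F"
      by (rule homotopic_nonzero_near) (use F1 balanced_continuous[OF F] in auto)
    then show ?case by (simp add: G0)
  next
    case (Suc n)
    have "homotopic_with_canon (\<lambda>_. True) (sphere 0 1) (-{0}) (G n) (G (Suc n))"
    proof (rule homotopic_nonzero_near[OF cont cont])
      fix z :: complex assume z: "z \<in> sphere 0 1"
      have "sqrt (m * d n) \<le> sqrt m" using m d0[of n] by (intro real_sqrt_le_mono) (simp add: mult_left_le)
      moreover have "0 < sqrt m" using m by simp
      ultimately show "cmod (G (Suc n) z - G n z) < cmod (G n z)"
        using step[OF z, of n] Gs[OF z, of n] by linarith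
    qed
    then show ?case using Suc.IH homotopic_with_trans by blast
  qed
  define f where "f z = F z + (\<Sum>n. G (Suc n) z - G n z)" for z
  have "uniform_limit (sphere 0 1) (\<lambda>n z. \<Sum>i<n. G (Suc i) z - G i z) (\<lambda>z. \<Sum>n. G (Suc n) z - G n z) sequentially"
  proof (rule Weierstrass_m_test[OF step])
    have "4 / 5 * sqrt (m * d n) = 4 / 5 * sqrt m * sqrt (1 - \<kappa> / 2) ^ n" for n
      by (simp add: d_def real_sqrt_mult real_sqrt_power)
    moreover have "summable (\<lambda>n. 4 / 5 * sqrt m * sqrt (1 - \<kappa> / 2) ^ n)"
      using \<kappa> by (intro summable_mult summable_geometric) auto
    ultimately show "summable (\<lambda>n. 4 / 5 * sqrt (m * d n))" by simp
  qed
  then have "uniform_limit (sphere 0 1) (\<lambda>n z. F z + (\<Sum>i<n. G (Suc i) z - G i z)) f sequentially"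
    unfolding f_def by (intro uniform_limit_add uniform_limit_const)
  moreover have "F z + (\<Sum>i<n. G (Suc i) z - G i z) = G n z" for n z
    using sum_lessThan_telescope[of "\<lambda>i. G i z" n] by (simp add: G0)
  ultimately have lim: "uniform_limit (sphere 0 1) G f sequentially" by simp
  have contf: "continuous_on (sphere 0 1) f"
    by (rule uniform_limit_theorem[OF _ lim]) (auto simp: cont)
  have near: "\<exists>n. \<forall>z\<in>sphere 0 1. cmod (f z - G n z) < e" if "e > 0" for e
    using uniform_limitD[OF lim that] unfolding eventually_sequentially by (metis dist_norm dist_commute order_refl)
  have unit: "cmod (f z) = 1" if z: "z \<in> sphere 0 1" for z
  proof -
    have "(\<lambda>n. G n z) \<longlonglongrightarrow> f z" using tendsto_uniform_limitI[OF lim z] .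
    then have "(\<lambda>n. 1 - (cmod (G n z))\<^sup>2) \<longlonglongrightarrow> 1 - (cmod (f z))\<^sup>2" by (intro tendsto_intros)
    moreover have "d \<longlonglongrightarrow> 0" unfolding d_def using \<kappa> by (intro LIMSEQ_realpow_zero) auto
    then have "(\<lambda>n. 1 - (cmod (G n z))\<^sup>2) \<longlonglongrightarrow> 0"
      by (rule Lim_null_comparison[rotated]) (use Gd[OF z] in auto)
    ultimately have "1 - (cmod (f z))\<^sup>2 = 0" by (rule LIMSEQ_unique)
    then show ?thesis by (simp add: power2_eq_1_iff) (metis norm_ge_zero neg_0_le_iff_le not_one_le_zero)
  qed
  have "homotopic_with_canon (\<lambda>_. True) (sphere 0 1) (-{0}) F f"
  proof -
    obtain n where n: "\<forall>z\<in>sphere 0 1. cmod (f z - G n z) < sqrt m" using near[of "sqrt m"] m by auto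
    have "homotopic_with_canon (\<lambda>_. True) (sphere 0 1) (-{0}) (G n) f"
      using n Gs by (intro homotopic_nonzero_near cont contf) (meson less_le_trans)
    then show ?thesis using hom homotopic_with_trans by blast
  qed
  moreover have "\<exists>A' H. balanced A' H \<and> (\<forall>z\<in>sphere 0 1. cmod (f z - H z) \<le> e)" if "e > 0" for e
    using near[OF that] bal by (meson less_imp_le)
  ultimately show ?thesis using contf unit by blast
qed

section \<open>Fourier coefficients and winding numbers\<close>

lemma circlepath_unit: "circlepath 0 1 t = exp (2 * of_real pi * \<i> * of_real t)"
  by (simp add: circlepath)

lemma circlepath_in_sphere: "circlepath 0 1 t \<in> sphere 0 1"
  by (simp add: circlepath_unit)

lemma has_integral_exp_2pi:
  "((\<lambda>t. exp (2 * of_real pi * \<i> * of_int k * of_real t)) has_integral (if k = 0 then 1 else 0)) {0..1::real}"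
proof (cases "k = 0")
  case True
  then show ?thesis using has_integral_const_real[of "1::complex" 0 1] by simp
next
  case False
  define c where "c = 2 * of_real pi * \<i> * of_int k"
  have c0: "c \<noteq> 0" using False by (simp add: c_def)
  have "((\<lambda>t. exp (c * of_real t)) has_integral (exp (c * of_real 1) / c - exp (c * of_real 0) / c)) {0..1::real}"
  proof (rule fundamental_theorem_of_calculus)
    fix t :: real
    have "((\<lambda>w. exp (c * w) / c) has_field_derivative exp (c * of_real t)) (at (of_real t))"
      using c0 by (auto intro!: derivative_eq_intros)
    then have "((\<lambda>t. exp (c * of_real t) / c) has_vector_derivative exp (c * of_real t)) (at t)"
      by (rule has_vector_derivative_real_field)
    then show "((\<lambda>t. exp (c * of_real t) / c) has_vector_derivative exp (c * of_real t)) (at t within {0..1})"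
      by (rule has_vector_derivative_at_within)
  qed simp
  moreover have "exp c = 1" using exp_integer_2pi[of "of_int k"] by (simp add: c_def mult_ac)
  ultimately show ?thesis using False by (simp add: c_def)
qed

lemma continuous_circle_lift:
  assumes "continuous_on (sphere 0 1) f"
  shows "continuous_on {0..1} (\<lambda>t. circle_lift f t * exp (- (2 * of_real pi * \<i> * of_int n * of_real t)))"
proof -
  have "continuous_on {0..1} (circlepath 0 1)"
    by (simp add: path_def[symmetric])
  then have "continuous_on {0..1} (circle_lift f)"
    unfolding circle_lift_def o_def
    by (rule continuous_on_compose2[OF assms]) (use circlepath_in_sphere in blast)
  then show ?thesis by (intro continuous_intros)
qed

lemma fourier_coeff_trig_poly:
  assumes "finite A" "\<And>z. z \<in> sphere 0 1 \<Longrightarrow> F z = (\<Sum>k\<in>A. c k * z powi k)"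
    "\<And>k. k \<notin> A \<Longrightarrow> c k = 0"
  shows "fourier_coeff F n = c n"
proof -
  have eq: "circle_lift F t * exp (- (2 * of_real pi * \<i> * of_int n * of_real t))
      = (\<Sum>k\<in>A. c k * exp (2 * of_real pi * \<i> * of_int (k - n) * of_real t))" for t
  proof -
    have "circlepath 0 1 t powi k * exp (- (2 * of_real pi * \<i> * of_int n * of_real t))
      = exp (2 * of_real pi * \<i> * of_int (k - n) * of_real t)" for k
      by (simp add: circlepath_unit exp_power_int exp_add[symmetric] algebra_simps)
    then show ?thesis
      by (simp add: circle_lift_def assms(2)[OF circlepath_in_sphere] sum_distrib_right mult.assoc)
  qed
  have "((\<lambda>t. \<Sum>k\<in>A. c k * exp (2 * of_real pi * \<i> * of_int (k - n) * of_real t)) has_integral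
      (\<Sum>k\<in>A. c k * (if k - n = 0 then 1 else 0))) {0..1}"
    by (intro has_integral_sum assms(1) has_integral_mult_right has_integral_exp_2pi)
  then have "fourier_coeff F n = (\<Sum>k\<in>A. c k * (if k - n = 0 then 1 else 0))"
    unfolding fourier_coeff_def eq by (rule integral_unique)
  also have "\<dots> = (\<Sum>k\<in>A. if k = n then c k else 0)" by (intro sum.cong) auto
  also have "\<dots> = c n" using assms(1,3) by (simp add: sum.delta)
  finally show ?thesis .
qed

lemma balanced_fourier_coeff:
  assumes "balanced A F"
  shows "cmod (fourier_coeff F (-n)) = cmod (fourier_coeff F n)"
proof -
  from assms obtain c where "finite A" "\<And>n. cmod (c (-n)) = cmod (c n)" "\<And>n. n \<notin> A \<Longrightarrow> c n = 0"
    "\<And>z. z \<in> sphere 0 1 \<Longrightarrow> F z = (\<Sum>n\<in>A. c n * z powi n)"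
    unfolding balanced_def by blast
  then show ?thesis using fourier_coeff_trig_poly[of A F c] by metis
qed

lemma fourier_coeff_diff_le:
  assumes f: "continuous_on (sphere 0 1) f" and g: "continuous_on (sphere 0 1) g"
    and e: "\<And>z. z \<in> sphere 0 1 \<Longrightarrow> cmod (f z - g z) \<le> e"
  shows "cmod (fourier_coeff f n - fourier_coeff g n) \<le> e"
proof -
  let ?w = "\<lambda>t::real. exp (- (2 * of_real pi * \<i> * of_int n * of_real t))"
  note I = integrable_continuous_real[OF continuous_circle_lift]
  have "fourier_coeff f n - fourier_coeff g n
      = integral {0..1} (\<lambda>t. circle_lift f t * ?w t - circle_lift g t * ?w t)"
    unfolding fourier_coeff_def by (rule integral_diff[OF I[OF f] I[OF g], symmetric])
  also have "cmod \<dots> \<le> e * (1 - 0)"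
  proof (rule integral_bound)
    show "continuous_on {0..1} (\<lambda>t. circle_lift f t * ?w t - circle_lift g t * ?w t)"
      by (intro continuous_on_diff continuous_circle_lift f g)
    fix t :: real assume "t \<in> {0..1}"
    have "cmod (circle_lift f t * ?w t - circle_lift g t * ?w t) = cmod (circle_lift f t - circle_lift g t) * cmod (?w t)"
      by (simp only: left_diff_distrib[symmetric] norm_mult)
    also have "cmod (?w t) = 1" by simp
    finally show "cmod (circle_lift f t * ?w t - circle_lift g t * ?w t) \<le> e"
      using e[OF circlepath_in_sphere] by (simp add: circle_lift_def)
  qed simp
  finally show ?thesis by simp
qed

lemma fourier_coeff_cnj: "fourier_coeff (\<lambda>z. cnj (f z)) n = cnj (fourier_coeff f (-n))"
  unfolding fourier_coeff_def integral_cnj by (simp add: circle_lift_def exp_cnj)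

lemma winding_number_circle_lift_homotopic:
  assumes "homotopic_with_canon (\<lambda>_. True) (sphere 0 1) (-{0}) f g"
  shows "winding_number (circle_lift f) 0 = winding_number (circle_lift g) 0"
proof -
  have "circle_lift h = h \<circ> exp \<circ> (\<lambda>t. 2 * of_real pi * of_real t * \<i>)" for h
    by (auto simp: circle_lift_def circlepath_unit mult_ac)
  then show ?thesis
    using winding_number_homotopic_loops[OF homotopic_circlemaps_imp_homotopic_loops[OF assms]] by simp
qed

section \<open>The initial function\<close>

text \<open>
  On the circle \<open>z = cis t\<close> the curve is \<open>((cos t - 1/2) + \<i> sin (2t)) / 2\<close>: a Lissajous curve of
  ratio 1 to 2, a real cosine plus \<open>\<i>\<close> times a real sine of another frequency, hence balanced. The shift by
  \<open>1/2\<close> puts the origin inside one of its two lobes. The winding numbers of the two lobes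
  are opposite, and the lobe is chosen so that the curve is homotopic to the identity.
\<close>

definition figure_eight :: "complex \<Rightarrow> complex" where
  "figure_eight z = Complex ((Re z - 1/2) / 2) (Re z * Im z)"

lemma balanced_figure_eight: "\<exists>A. balanced A figure_eight"
proof -
  have 0: "balanced {0} (\<lambda>_. -1/4)"
    unfolding balanced_def by (intro conjI exI[of _ "\<lambda>n. if n = 0 then -1/4 else 0"]) auto
  have 1: "trig_poly_on {1,-1} (\<lambda>z. of_real (Re (z powi 1)))"
    by (rule trig_poly_on_Re_powi) auto
  have "trig_poly_on {2,-2} (\<lambda>z. (-\<i>/4) * z powi 2 + (\<i>/4) * z powi (-2))"
    by (intro trig_poly_on_add trig_poly_on_monom) auto
  then have 2: "trig_poly_on {2,-2} (\<lambda>z. of_real (Re z * Im z))"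
  proof (rule trig_poly_on_cong)
    fix z :: complex assume "z \<in> sphere 0 1"
    from cnj_powi_sphere[OF this, of 2] have "z powi (-2) = (cnj z)\<^sup>2" by simp
    then show "of_real (Re z * Im z) = (-\<i>/4) * z powi 2 + (\<i>/4) * z powi (-2)"
      by (simp add: complex_eq_iff power2_eq_square)
  qed
  have "balanced ({0} \<union> {1,-1}) (\<lambda>z. -1/4 + (1/2) * of_real (Re (z powi 1)))"
    by (rule balanced_add_real[OF 0 1]) auto
  then have "balanced ({0} \<union> {1,-1} \<union> {2,-2}) (\<lambda>z. (-1/4 + (1/2) * of_real (Re (z powi 1))) + \<i> * of_real (Re z * Im z))"
    by (rule balanced_add_real[OF _ 2]) auto
  moreover have "(\<lambda>z. (-1/4 + (1/2) * of_real (Re (z powi 1))) + \<i> * of_real (Re z * Im z)) = figure_eight"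
    by (auto simp: figure_eight_def complex_eq_iff)
  ultimately show ?thesis by auto
qed

lemma homotopic_figure_eight:
  "homotopic_with_canon (\<lambda>_. True) (sphere 0 1) (-{0}) figure_eight (\<lambda>z. z)"
proof (rule homotopic_with_linear)
  show "continuous_on (sphere 0 1) figure_eight"
    using balanced_figure_eight balanced_continuous by blast
  fix z :: complex assume "z \<in> sphere 0 1"
  then have xy: "(Re z)\<^sup>2 + (Im z)\<^sup>2 = 1" by (metis cmod_power2 dist_0_norm mem_sphere one_power2)
  have False if s: "0 \<le> s" "s \<le> 1" and eq: "0 = (1 - s) *\<^sub>R figure_eight z + s *\<^sub>R z" for s
  proof -
    define x y where "x = Re z" and "y = Im z"
    have re: "(1 - s) * ((x - 1/2) / 2) + s * x = 0" using arg_cong[OF eq, of Re] by (simp add: figure_eight_def x_def)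
    have im: "y * ((1 - s) * x + s) = 0" using arg_cong[OF eq, of Im] by (simp add: figure_eight_def x_def y_def algebra_simps)
    show False
    proof (cases "y = 0")
      case True
      then have "x = 1 \<or> x = -1" using xy by (simp add: x_def y_def power2_eq_1_iff)
      then show False
      proof
        assume "x = 1"
        with re have "(1 - s) / 4 + s = 0" by simp
        then have "3 * s = -1" by (simp add: field_simps)
        with s show False by simp
      next
        assume "x = -1"
        with re have "(1 - s) * 3 = - 4 * s" by (simp add: field_simps)
        then have "3 + s = 0" by (simp add: algebra_simps)
        with s show False by linarith
      qed
    next
      case False
      then have e: "(1 - s) * x = - s" using im by simp
      have "s < 1" using e s by (cases "s = 1") auto
      then have "x \<le> 0" using e s by (smt (verit) mult_pos_pos)
      then have "s * x \<le> 0" using s by (simp add: mult_nonneg_nonpos)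
      have "(1 - s) * ((x - 1/2) / 2) = ((1 - s) * x) / 2 - (1 - s) / 4" by (simp add: field_simps)
      with re e have "- s / 2 - (1 - s) / 4 + s * x = 0" by metis
      then have "1 + s = 4 * (s * x)" by (simp add: field_simps)
      then show False using \<open>s * x \<le> 0\<close> s by linarith
    qed
  qed
  then show "closed_segment (figure_eight z) z \<subseteq> -{0}"
    by (auto simp: closed_segment_def)
qed auto

lemma figure_eight_bounds:
  assumes "z \<in> sphere 0 1"
  shows "figure_eight z \<noteq> 0" "cmod (figure_eight z) < 1"
proof -
  have "(Re z)\<^sup>2 + (Im z)\<^sup>2 = 1" using assms by (metis cmod_power2 dist_0_norm mem_sphere one_power2)
  moreover have "\<bar>Re z\<bar> \<le> 1" using assms abs_Re_le_cmod[of z] by simp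
  moreover have "\<bar>Re z * Im z\<bar> \<le> ((Re z)\<^sup>2 + (Im z)\<^sup>2) / 2"
    using sum_squares_bound[of "Re z" "Im z"] sum_squares_bound[of "Re z" "- Im z"] by (auto simp: abs_le_iff)
  moreover have "\<bar>(x - 1/2) / 2\<bar> \<le> 3/4" if "\<bar>x\<bar> \<le> 1" for x :: real
    using that by (simp add: abs_le_iff field_simps)
  ultimately have "\<bar>Re z * Im z\<bar> \<le> 1/2" "\<bar>(Re z - 1/2) / 2\<bar> \<le> 3/4" by auto
  then have "(Re z * Im z)\<^sup>2 \<le> (1/2)\<^sup>2" "((Re z - 1/2) / 2)\<^sup>2 \<le> (3/4)\<^sup>2"
    by (metis abs_ge_zero power2_abs power_mono)+
  then have "(cmod (figure_eight z))\<^sup>2 < 1"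
    unfolding cmod_power2 figure_eight_def by (simp add: power2_eq_square)
  then show "cmod (figure_eight z) < 1" by (simp add: abs_square_less_1)
  show "figure_eight z \<noteq> 0"
    using homotopic_with_imp_subset1[OF homotopic_figure_eight] assms by auto
qed

theorem mainTheorem1:
  shows "\<exists>f g :: complex \<Rightarrow> complex.
    continuous_on (sphere 0 1) f \<and> f \<in> sphere 0 1 \<rightarrow> sphere 0 1 \<and>
    continuous_on (sphere 0 1) g \<and> g \<in> sphere 0 1 \<rightarrow> sphere 0 1 \<and>
    (\<forall>n::int. cmod (fourier_coeff f n) = cmod (fourier_coeff g n)) \<and>
    winding_number (circle_lift f) 0 \<noteq> winding_number (circle_lift g) 0"
proof -
  obtain A where A: "balanced A figure_eight" using balanced_figure_eight by blast
  obtain f where f: "continuous_on (sphere 0 1) f" "\<And>z. z \<in> sphere 0 1 \<Longrightarrow> cmod (f z) = 1"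
    and hom: "homotopic_with_canon (\<lambda>_. True) (sphere 0 1) (-{0}) figure_eight f"
    and approx: "\<And>e. e > 0 \<Longrightarrow> \<exists>A' G. balanced A' G \<and> (\<forall>z\<in>sphere 0 1. cmod (f z - G z) \<le> e)"
    using unimodular_limit[OF A] figure_eight_bounds by blast
  have sym: "cmod (fourier_coeff f (-n)) = cmod (fourier_coeff f n)" for n
  proof -
    have "\<bar>cmod (fourier_coeff f (-n)) - cmod (fourier_coeff f n)\<bar> \<le> e" if e: "e > 0" for e
    proof -
      obtain A' G where G: "balanced A' G" "\<forall>z\<in>sphere 0 1. cmod (f z - G z) \<le> e / 2"
        using approx[OF half_gt_zero[OF e]] by blast
      have "cmod (fourier_coeff f k - fourier_coeff G k) \<le> e / 2" for k
        using G by (intro fourier_coeff_diff_le f balanced_continuous[OF G(1)]) auto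
      then have "\<bar>cmod (fourier_coeff f k) - cmod (fourier_coeff G k)\<bar> \<le> e / 2" for k
        by (rule order.trans[OF norm_triangle_ineq3])
      from this[of n] this[of "-n"] show ?thesis
        using balanced_fourier_coeff[OF G(1), of n] by linarith
    qed
    then have "\<bar>cmod (fourier_coeff f (-n)) - cmod (fourier_coeff f n)\<bar> \<le> 0" by (rule field_le_epsilon) simp
    then show ?thesis by simp
  qed
  have homf: "homotopic_with_canon (\<lambda>_. True) (sphere 0 1) (-{0}) (\<lambda>z. z) f"
    using homotopic_with_trans[OF homotopic_with_symD[OF homotopic_figure_eight] hom] .
  have wf: "winding_number (circle_lift f) 0 = 1"
    using winding_number_circle_lift_homotopic[OF homf] winding_number_circlepath_centre[of 1 0]
    by (simp add: circle_lift_def o_def)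
  have "homotopic_with_canon (\<lambda>_. True) (sphere 0 1) (-{0}) (cnj \<circ> (\<lambda>z. z)) (cnj \<circ> f)"
    by (rule homotopic_with_compose_continuous_left[OF homf]) (auto intro!: continuous_intros)
  then have "winding_number (circle_lift (cnj \<circ> f)) 0 = winding_number (cnj \<circ> circlepath 0 1) 0"
    using winding_number_circle_lift_homotopic by (force simp: circle_lift_def o_def)
  also have "\<dots> = -1"
    using winding_number_cnj[of "circlepath 0 1" 0] winding_number_circlepath_centre[of 1 0] by simp
  finally have wg: "winding_number (circle_lift (cnj \<circ> f)) 0 = -1" .
  show ?thesis
  proof (rule exI[of _ f], rule exI[of _ "cnj \<circ> f"], intro conjI allI)
    show "continuous_on (sphere 0 1) (cnj \<circ> f)"
      unfolding o_def by (intro continuous_intros f(1))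
    show "cmod (fourier_coeff f n) = cmod (fourier_coeff (cnj \<circ> f) n)" for n
      using sym[of n] by (simp add: o_def fourier_coeff_cnj)
    show "winding_number (circle_lift f) 0 \<noteq> winding_number (circle_lift (cnj \<circ> f)) 0"
      using wf wg by simp
  qed (use f in auto)
qed

end
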